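(* Suppose there exists a nonnegative random variable $K\in L^1(\mathcal F_0,P)$ such that $$\frac{d(\theta Q)|_{\mathcal F_0}}{dQ|_{\mathcal F_0}}\ \le\ K\prod_{V\in\mathcal A} Z_0^V\qquad P\text{-a.s.}$$ Then $$\prod_{V\in\mathcal X} Z_0^V\cdot (\theta Q)|_{\mathcal F_0}$$ (the measure on $\mathcal F_0$ with density $\prod_{V\in\mathcal X}Z_0^V$ with respect to $(\theta Q)|_{\mathcal F_0}$) is a counterfactual distribution at baseline on $\mathcal F_0$; it is absolutely continuous with respect to $P|_{\mathcal F_0}$ and it imposes contemporaneously independent outcomes.
   Context: Setting. $\mathcal V$ is a finite set of modules and $(\Omega,\mathcal F,Q)$ is a probability space. Each $V\in\mathcal V$ has a baseline random variable $V_0$ on $\Omega$; the family $\mathcal V_0=\{V_0\}_{V\in\mathcal V}$ is mutually independent under $Q$. Each $V_0$ occurs at a time $T(V_0)\le 0$, the ordering of these times being known. The past of $V_0$ is $p(V_0)=\{V_0'\in\mathcal V_0 : T(V_0')<T(V_0)\}$; $p(V)$ also denotes the corresponding set of modules. For $\mathcal W\subset\mathcal V$, $\mathcal F_0^{\mathcal W}$ is the ($Q$-completed) $\sigma$-algebra generated by $\{V_0\}_{V\in\mathcal W}$, $\mathcal F_0^V=\mathcal F_0^{\{V\}}$, $\mathcal F_0=\mathcal F_0^{\mathcal V}$. A probability measure $P'$ imposes contemporaneously independent outcomes if for every $V_0\in\mathcal V_0$, under $P'$, $V_0$ is independent of the family $\{V_0'\in\mathcal V_0: T(V_0')=T(V_0)\}\setminus\{V_0\}$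 conditionally on $p(V_0)$. The factual measure $P$ is a probability measure on $(\Omega,\mathcal F)$ with $P\ll Q$ that imposes contemporaneously independent outcomes. $\{Z_0^V\}_{V\in\mathcal V}$ is a family of nonnegative random variables such that $Z_0^V$ is $\mathcal F_0^{p(V)\cup\{V\}}$-measurable, $E_Q[Z_0^V\mid\mathcal F_0^{p(V)}]=1$, and $\frac{dP|_{\mathcal F_0}}{dQ|_{\mathcal F_0}}=\prod_{V\in\mathcal V}Z_0^V$ $Q$-a.s. Actions. $\mathcal A\subset\mathcal V$ is the set of modules that may be directly intervened on and $\mathcal X=\mathcal V\setminus\mathcal A$. An action is a measurable transformation $\theta$ of $(\Omega,\mathcal F)$. Write $\theta P'(F)=P'(\theta^{-1}(F))$ for a probability measure $P'$, and $\theta^*H(\omega)=H(\theta(\omega))$ for a random variable $H$. It is assumed that $\theta Q\ll Q$; that $\theta^*\eta=\eta$ for every $\mathcal F_0^V$-measurable $\eta$ and every $V\in\mathcal X$; and that $\theta^*\eta$ is $\mathcal F_0^{p(V)\cap\mathcal X}$-measurable for every $\mathcal F_0^V$-measurable $\eta$ and every $V\in\mathcal A$. A probability measure $P_\theta$ (on $\mathcal F_0$, or on $\mathcal F$) is a counterfactual distribution at baseline if for every $V\in\mathcal V$, every (bounded) $\mathcal F_0^V$-measurable $\eta$ and every bounded $\mathcal F_0^{p(V)}$-measurable $h$: $E_{P_\theta}[h\eta]=E_{P_\theta}[h\,\theta^*\eta]$ if $V\in\mathcal A$, and $E_{P_\theta}[h\eta]=E_{P_\theta}\big[h\,\theta^*E_P[\eta\mid\mathcal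 F_0^{p(V)}]\big]$ if $V\in\mathcal X$ (for any version of the conditional expectation).
   Formalization: The bound on d(θQ)/dQ by K times the product of Z_0^V over A is required Q-a.s. instead of P-a.s.; with P-a.s. the claim fails (Ω={0,1}, Q uniform, P the point mass at 1, one intervened module, θ constantly 0, K=0). *)

theory Defs
  imports "HOL-Probability.Probability"
begin

text \<open>
  Modules are the elements of a finite set \<open>VV\<close>; \<open>T v\<close> is the time at which the baseline variable
  \<open>X v\<close> occurs, and \<open>X v\<close> takes values in the measurable space \<open>N v\<close>.
\<close>

definition past :: "'v set \<Rightarrow> ('v \<Rightarrow> real) \<Rightarrow> 'v \<Rightarrow> 'v set" where
  "past VV T v = {w \<in> VV. T w < T v}"

definition generated_sets ::
    "'a set \<Rightarrow> ('v \<Rightarrow> 'b measure) \<Rightarrow> ('v \<Rightarrow> 'a \<Rightarrow> 'b) \<Rightarrow> 'v set \<Rightarrow> 'a set set" where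
  "generated_sets \<Omega> N X W = (\<Union>v\<in>W. {X v -` S \<inter> \<Omega> | S. S \<in> sets (N v)})"

definition baseline_sigma ::
    "'a set \<Rightarrow> ('v \<Rightarrow> 'b measure) \<Rightarrow> ('v \<Rightarrow> 'a \<Rightarrow> 'b) \<Rightarrow> 'v set \<Rightarrow> 'a measure" where
  "baseline_sigma \<Omega> N X W = sigma \<Omega> (generated_sets \<Omega> N X W)"

text \<open>
  The \<open>Q\<close>-completion is taken inside the ambient \<open>\<sigma>\<close>-algebra: all its \<open>Q\<close>-null sets are
  adjoined. If \<open>Q\<close> is complete, these are all subsets of \<open>Q\<close>-null sets.
\<close>

definition F0 ::
    "'a measure \<Rightarrow> ('v \<Rightarrow> 'b measure) \<Rightarrow> ('v \<Rightarrow> 'a \<Rightarrow> 'b) \<Rightarrow> 'v set \<Rightarrow> 'a measure" where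
  "F0 Q N X W = sigma (space Q) (generated_sets (space Q) N X W \<union> null_sets Q)"

definition cond_indep_sigma ::
    "'a measure \<Rightarrow> 'a measure \<Rightarrow> 'a measure \<Rightarrow> 'a measure \<Rightarrow> bool" where
  "cond_indep_sigma M H G1 G2 \<longleftrightarrow>
     (\<forall>A\<in>sets G1. \<forall>B\<in>sets G2. AE \<omega> in M.
        real_cond_exp M H (indicator (A \<inter> B)) \<omega>
          = real_cond_exp M H (indicator A) \<omega> * real_cond_exp M H (indicator B) \<omega>)"

text \<open>
  The measure \<open>P'\<close> may live on any \<open>\<sigma>\<close>-algebra making all baseline variables measurable.
\<close>

definition imposes_contemp_indep ::
    "'v set \<Rightarrow> ('v \<Rightarrow> real) \<Rightarrow> ('v \<Rightarrow> 'b measure) \<Rightarrow> ('v \<Rightarrow> 'a \<Rightarrow> 'b) \<Rightarrow> 'a measure \<Rightarrow> bool" where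
  "imposes_contemp_indep VV T N X P' \<longleftrightarrow>
     prob_space P' \<and>
     (\<forall>v\<in>VV. X v \<in> P' \<rightarrow>\<^sub>M N v) \<and>
     (\<forall>v\<in>VV. cond_indep_sigma P'
        (baseline_sigma (space P') N X (past VV T v))
        (baseline_sigma (space P') N X {v})
        (baseline_sigma (space P') N X ({w\<in>VV. T w = T v} - {v})))"

text \<open>
  The requirement that \<open>\<theta>\<close> fix \<open>F0 {v}\<close>-measurable variables is an almost sure equality, as for any
  random variables: \<open>F0 {v}\<close> contains all \<open>Q\<close>-null sets, so a pointwise equality would force \<open>\<theta>\<close> to
  be the identity whenever singletons are \<open>Q\<close>-null. Composition with \<open>\<theta>\<close> respects \<open>Q\<close>-a.s. equality
  by the absolute continuity of \<open>distr Q Q \<theta>\<close>.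
\<close>

definition baseline_action ::
    "'v set \<Rightarrow> ('v \<Rightarrow> real) \<Rightarrow> ('v \<Rightarrow> 'b measure) \<Rightarrow> ('v \<Rightarrow> 'a \<Rightarrow> 'b) \<Rightarrow> 'a measure \<Rightarrow>
      'v set \<Rightarrow> ('a \<Rightarrow> 'a) \<Rightarrow> bool" where
  "baseline_action VV T N X Q \<A> \<theta> \<longleftrightarrow>
     \<theta> \<in> Q \<rightarrow>\<^sub>M Q \<and>
     absolutely_continuous Q (distr Q Q \<theta>) \<and>
     (\<forall>v\<in>VV - \<A>. \<forall>\<eta>::'a \<Rightarrow> real. \<eta> \<in> borel_measurable (F0 Q N X {v}) \<longrightarrow>
        (AE \<omega> in Q. \<eta> (\<theta> \<omega>) = \<eta> \<omega>)) \<and>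
     (\<forall>v\<in>\<A>. \<forall>\<eta>::'a \<Rightarrow> real. \<eta> \<in> borel_measurable (F0 Q N X {v}) \<longrightarrow>
        (\<lambda>\<omega>. \<eta> (\<theta> \<omega>)) \<in> borel_measurable (F0 Q N X (past VV T v \<inter> (VV - \<A>))))"

text \<open>
  In the second clause \<open>m\<close> ranges over all versions of the conditional expectation of \<open>\<eta>\<close> given the
  past under \<open>P\<close>. A version may be unbounded on a null set, hence the explicit integrability, without
  which the Bochner integral could take its default value 0.
\<close>

definition counterfactual_at_baseline ::
    "'v set \<Rightarrow> ('v \<Rightarrow> real) \<Rightarrow> ('v \<Rightarrow> 'b measure) \<Rightarrow> ('v \<Rightarrow> 'a \<Rightarrow> 'b) \<Rightarrow> 'a measure \<Rightarrow>
      'a measure \<Rightarrow> 'v set \<Rightarrow> ('a \<Rightarrow> 'a) \<Rightarrow> 'a measure \<Rightarrow> bool" where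
  "counterfactual_at_baseline VV T N X Q P \<A> \<theta> P\<theta> \<longleftrightarrow>
     prob_space P\<theta> \<and>
     (sets P\<theta> = sets (F0 Q N X VV) \<or> sets P\<theta> = sets Q) \<and>
     (\<forall>v\<in>VV. \<forall>(\<eta>::'a \<Rightarrow> real) (h::'a \<Rightarrow> real).
        \<eta> \<in> borel_measurable (F0 Q N X {v}) \<longrightarrow> bounded (\<eta> ` space Q) \<longrightarrow>
        h \<in> borel_measurable (F0 Q N X (past VV T v)) \<longrightarrow> bounded (h ` space Q) \<longrightarrow>
        (v \<in> \<A> \<longrightarrow>
           (\<integral>\<omega>. h \<omega> * \<eta> \<omega> \<partial>P\<theta>) = (\<integral>\<omega>. h \<omega> * \<eta> (\<theta> \<omega>) \<partial>P\<theta>)) \<and>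
        (v \<in> VV - \<A> \<longrightarrow>
           (\<forall>m::'a \<Rightarrow> real.
              m \<in> borel_measurable (F0 Q N X (past VV T v)) \<longrightarrow>
              (AE \<omega> in P. m \<omega> = real_cond_exp P (F0 Q N X (past VV T v)) \<eta> \<omega>) \<longrightarrow>
              integrable P\<theta> (\<lambda>\<omega>. h \<omega> * m (\<theta> \<omega>)) \<and>
              (\<integral>\<omega>. h \<omega> * \<eta> \<omega> \<partial>P\<theta>) = (\<integral>\<omega>. h \<omega> * m (\<theta> \<omega>) \<partial>P\<theta>))))"

text \<open>
  A pitfall for the existence criterion: bounding the density of \<open>distr Q Q \<theta>\<close> on \<open>F0\<close> by
  \<open>K * (\<Prod>v\<in>\<A>. Z v)\<close> only \<open>P\<close>-almost surely says nothing where \<open>(\<Prod>v\<in>VV. Z v) = 0\<close>, and is not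
  enough. Take one module with values 0 and 1, which is intervened on, with \<open>Q\<close> uniform,
  \<open>P\<close> the point mass at 1 (so \<open>Z\<close> is twice the indicator of 1) and \<open>\<theta>\<close> constantly 0. The bound holds
  \<open>P\<close>-a.s. with \<open>K = 0\<close>, but \<open>distr Q Q \<theta>\<close> is the point mass at 0, which is not absolutely continuous
  with respect to \<open>P\<close>. The bound is therefore required \<open>Q\<close>-almost surely.
\<close>

end

theory Submission
  imports Defs
begin

text \<open>
  An action replaces the value of each intervened module by a function of the earlier modules that
  are not intervened on, and leaves the other modules alone. Two consequences drive everything.
  The pullback by \<open>\<theta>\<close> maps the information carried by a set of modules that contains all
  predecessors of its members into the part of this information carried by non-intervened modules
  (lemma \<open>theta_measurable_F\<close>), and the latter part is invariant under \<open>\<theta>\<close> up to null sets (lemma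
  \<open>comp_theta_invariant\<close>).

  Expectations under the candidate \<open>P\<theta>\<close> are integrals
  \<open>\<integral> f(\<theta> \<omega>) * (\<Prod>v\<in>VV - \<A>. Z v (\<theta> \<omega>)) \<partial>Q\<close>. Let \<open>v\<close> be a non-intervened module. Its variable is
  not moved by \<open>\<theta>\<close> and is \<open>Q\<close>-independent of the other modules, so taking conditional expectations
  given the past of \<open>v\<close> commutes with composition with \<open>\<theta>\<close> (lemma \<open>cond_exp_comp_theta\<close>). In
  particular the factor \<open>Z v \<circ> \<theta>\<close>, like \<open>Z v\<close>, has conditional expectation 1 given the past, and in an
  integral over early modules the densities of all later modules can be dropped one by one, the
  latest first (lemma \<open>nn_integral_drop_later_densities\<close>). This gives total mass 1. It also gives
  Bayes' formula: under \<open>P\<theta>\<close> the conditional expectation of a function \<open>\<eta>\<close> of the module \<open>v\<close> is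
  \<open>E\<^sub>Q[\<eta> * Z v | past of v]\<close> (lemma \<open>real_cond_exp_bayes\<close>).

  The right-hand side of this formula mentions neither \<open>\<theta>\<close> nor \<open>\<A>\<close>. For the identity action without
  intervened modules the same formula computes the conditional expectation under \<open>P\<close>, hence both
  conditional expectations agree; together with the invariance of past information under \<open>\<theta>\<close> this is
  the defining property of a counterfactual distribution for a non-intervened \<open>v\<close>. For an intervened
  \<open>v\<close>, idempotence of \<open>\<theta>\<close> on baseline information gives \<open>\<eta> \<circ> \<theta> = \<eta>\<close> almost surely under \<open>P\<theta>\<close>.

  Contemporaneous independence comes from the freedom in the conditioning algebra: in both cases the
  conditional expectation of a function of \<open>v\<close> is the same given the past of \<open>v\<close> and given the past
  together with the other variables that occur at the same time (lemma
  \<open>real_cond_exp_counterfactual_past\<close>). Absolute continuity is a matter of zeros: where the density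
  \<open>\<Prod>v\<in>VV. Z v\<close> of \<open>P\<close> vanishes, either \<open>\<Prod>v\<in>VV - \<A>. Z v\<close> vanishes, or \<open>\<Prod>v\<in>\<A>. Z v\<close> does, and then
  the assumed bound annihilates the density of the image of \<open>Q\<close> under \<open>\<theta>\<close>.
\<close>

section \<open>Agreement up to null sets and conditional independence\<close>

definition agree_mod_null :: "'a measure \<Rightarrow> 'a set \<Rightarrow> 'a set \<Rightarrow> bool" where
  "agree_mod_null M A B \<longleftrightarrow> A - B \<in> null_sets M \<and> B - A \<in> null_sets M"

lemma agree_mod_null_sym: "agree_mod_null M A B \<Longrightarrow> agree_mod_null M B A"
  by (auto simp: agree_mod_null_def)

lemma agree_mod_null_AE:
  assumes "agree_mod_null M A B"
  shows "AE x in M. x \<in> A \<longleftrightarrow> x \<in> B"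
proof -
  have "A - B \<in> null_sets M" "B - A \<in> null_sets M" using assms by (simp_all add: agree_mod_null_def)
  from AE_not_in[OF this(1)] AE_not_in[OF this(2)] show ?thesis by eventually_elim blast
qed

lemma AE_agree_mod_null:
  assumes "AE x in M. x \<in> A \<longleftrightarrow> x \<in> B" "A \<in> sets M" "B \<in> sets M"
  shows "agree_mod_null M A B"
proof -
  have "AE x in M. x \<notin> A - B" "AE x in M. x \<notin> B - A" using assms(1) by (eventually_elim, blast)+
  then show ?thesis
    using assms(2,3) AE_iff_null_sets[of "A - B" M] AE_iff_null_sets[of "B - A" M]
    unfolding agree_mod_null_def by blast
qed

lemma agree_mod_null_emeasure:
  assumes "agree_mod_null M A B" "A \<in> sets M" "B \<in> sets M"
  shows "emeasure M A = emeasure M B"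
  using agree_mod_null_AE[OF assms(1)] assms(2,3) by (rule emeasure_eq_AE)

lemma agree_mod_null_mono:
  assumes "A - B \<subseteq> C" "B - A \<subseteq> C" "A \<in> sets M" "B \<in> sets M" "C \<in> null_sets M"
  shows "agree_mod_null M A B"
  using assms unfolding agree_mod_null_def by (meson null_sets_subset sets.Diff)

lemma agree_mod_null_Int:
  assumes "agree_mod_null M A A'" "agree_mod_null M B B'"
    and "A \<in> sets M" "B \<in> sets M" "A' \<in> sets M" "B' \<in> sets M"
  shows "agree_mod_null M (A \<inter> B) (A' \<inter> B')"
  by (rule agree_mod_null_mono[where C = "(A - A') \<union> (A' - A) \<union> (B - B') \<union> (B' - B)"])
     (use assms in \<open>auto simp: agree_mod_null_def\<close>)

lemma agree_mod_null_UN: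
  assumes "\<And>i::nat. agree_mod_null M (A i) (B i)" "\<And>i. A i \<in> sets M" "\<And>i. B i \<in> sets M"
  shows "agree_mod_null M (\<Union>i. A i) (\<Union>i. B i)"
  by (rule agree_mod_null_mono[where C = "(\<Union>i. A i - B i) \<union> (\<Union>i. B i - A i)"])
     (use assms in \<open>auto simp: agree_mod_null_def\<close>)

lemma agree_mod_null_Compl:
  assumes "agree_mod_null M A B" "A \<in> sets M" "B \<in> sets M"
  shows "agree_mod_null M (space M - A) (space M - B)"
  by (rule agree_mod_null_mono[where C = "(A - B) \<union> (B - A)"])
     (use assms in \<open>auto simp: agree_mod_null_def\<close>)

lemma nn_integral_subalgebra_eqI:
  assumes "subalgebra M G" "subalgebra M' G"
    and "\<And>A. A \<in> sets G \<Longrightarrow> emeasure M A = emeasure M' A"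
    and "f \<in> borel_measurable G"
  shows "integral\<^sup>N M f = integral\<^sup>N M' f"
proof -
  have "restr_to_subalg M G = restr_to_subalg M' G"
    by (rule measure_eqI)
       (use assms in \<open>auto simp: sets_restr_to_subalg emeasure_restr_to_subalg\<close>)
  then show ?thesis using assms nn_integral_subalgebra2 by metis
qed

text \<open>
  This passes from the completed algebras, on which the action is well behaved, to the algebras
  generated by the variables alone, in terms of which conditional independence is required.
\<close>

lemma real_cond_exp_agree_mod_null:
  fixes f :: "'a \<Rightarrow> real"
  assumes M: "finite_measure M" and sub: "subalgebra M G" "subalgebra G G\<^sub>0"
    and approx: "\<And>A. A \<in> sets G \<Longrightarrow> \<exists>B\<in>sets G\<^sub>0. agree_mod_null M A B"
    and f: "integrable M f"
  shows "AE x in M. real_cond_exp M G f x = real_cond_exp M G\<^sub>0 f x"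
proof -
  interpret finite_measure M by fact
  have sub0: "subalgebra M G\<^sub>0" using sub by (auto simp: subalgebra_def)
  interpret G: finite_measure_subalgebra M G by unfold_locales fact
  interpret G0: finite_measure_subalgebra M G\<^sub>0 by unfold_locales fact
  show ?thesis
  proof (rule G.real_cond_exp_charact)
    show "integrable M (real_cond_exp M G\<^sub>0 f)" by (rule G0.real_cond_exp_int(1)[OF f])
    show "real_cond_exp M G\<^sub>0 f \<in> borel_measurable G"
      by (rule measurable_from_subalg[OF sub(2) borel_measurable_cond_exp])
    fix A assume A: "A \<in> sets G"
    then obtain B where B: "B \<in> sets G\<^sub>0" and AB: "agree_mod_null M A B" using approx by blast
    have meas: "A \<in> sets M" "B \<in> sets M" using A B sub(1) sub0 by (auto simp: subalgebra_def)
    have AB': "AE x in M. x \<in> A \<longleftrightarrow> x \<in> B" by (rule agree_mod_null_AE[OF AB])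
    have swap: "(LINT x:A|M. g x) = (LINT x:B|M. g x)" if "integrable M g" for g :: "'a \<Rightarrow> real"
      unfolding set_lebesgue_integral_def
      by (rule integral_cong_AE) (use that meas AB' in \<open>auto simp: indicator_def\<close>)
    show "(LINT x:A|M. f x) = (LINT x:A|M. real_cond_exp M G\<^sub>0 f x)"
      using swap[OF f] swap[OF G0.real_cond_exp_int(1)[OF f]] G0.real_cond_exp_intA[OF f B] by simp
  qed (fact f)
qed

text \<open>
  If enlarging the conditioning algebra from \<open>G\<close> to \<open>H\<close> does not change the prediction of \<open>A\<close>, then
  \<open>A\<close> is conditionally independent given \<open>G\<close> of everything in \<open>H\<close>: condition first on \<open>H\<close>, pull out
  the indicator of the event in \<open>H\<close>, then condition on \<open>G\<close> and pull out the prediction of \<open>A\<close>.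
\<close>

lemma cond_indep_sigmaI:
  assumes M: "finite_measure M" and sub: "subalgebra M H" "subalgebra H G"
    and G1: "sets G1 \<subseteq> sets M" and G2: "sets G2 \<subseteq> sets H"
    and eq: "\<And>A. A \<in> sets G1 \<Longrightarrow>
      AE x in M. real_cond_exp M H (indicator A) x = real_cond_exp M G (indicator A) x"
  shows "cond_indep_sigma M G G1 G2"
  unfolding cond_indep_sigma_def
proof (intro ballI)
  interpret finite_measure M by fact
  have subG: "subalgebra M G" using sub by (auto simp: subalgebra_def)
  interpret H: finite_measure_subalgebra M H by unfold_locales fact
  interpret G: finite_measure_subalgebra M G by unfold_locales fact
  fix A B assume A: "A \<in> sets G1" and B: "B \<in> sets G2"
  have meas: "A \<in> sets M" "B \<in> sets H" "B \<in> sets M" using A B G1 G2 sub by (auto simp: subalgebra_def)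
  let ?a = "indicator A :: _ \<Rightarrow> real" and ?b = "indicator B :: _ \<Rightarrow> real"
  have int: "integrable M ?a" "integrable M ?b" "integrable M (\<lambda>x. ?b x * ?a x)"
    using meas by (auto simp: integrable_indicator_iff less_top[symmetric] intro!: integrable_real_mult_indicator)
  let ?e = "real_cond_exp M G ?a"
  have ie: "integrable M (\<lambda>x. ?e x * ?b x)"
    using integrable_real_mult_indicator[OF meas(3) G.real_cond_exp_int(1)[OF int(1)]] by simp
  have 1: "AE x in M. real_cond_exp M G (\<lambda>x. ?b x * ?a x) x =
      real_cond_exp M G (real_cond_exp M H (\<lambda>x. ?b x * ?a x)) x"
    using G.real_cond_exp_nested_subalg[OF sub int(3)] by auto
  have 2: "AE x in M. real_cond_exp M H (\<lambda>x. ?b x * ?a x) x = ?b x * real_cond_exp M H ?a x"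
    by (rule H.real_cond_exp_mult) (use meas int in auto)
  have 3: "AE x in M. real_cond_exp M H (\<lambda>x. ?b x * ?a x) x = ?e x * ?b x"
    using 2 eq[OF A] by eventually_elim simp
  have 4: "AE x in M. real_cond_exp M G (real_cond_exp M H (\<lambda>x. ?b x * ?a x)) x =
      real_cond_exp M G (\<lambda>x. ?e x * ?b x) x"
    by (rule G.real_cond_exp_cong[OF 3]) (use ie in auto)
  have 5: "AE x in M. real_cond_exp M G (\<lambda>x. ?e x * ?b x) x = ?e x * real_cond_exp M G ?b x"
    by (rule G.real_cond_exp_mult) (use meas ie in auto)
  have "indicator (A \<inter> B) = (\<lambda>x. ?b x * ?a x)" by (auto simp: indicator_def)
  then show "AE \<omega> in M. real_cond_exp M G (indicator (A \<inter> B)) \<omega>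
      = real_cond_exp M G ?a \<omega> * real_cond_exp M G ?b \<omega>"
    using 1 4 5 by (auto elim: eventually_elim2)
qed

section \<open>Baseline algebras under the reference measure\<close>

lemma generated_sets_subset: "generated_sets \<Omega> N X W \<subseteq> Pow \<Omega>"
  by (auto simp: generated_sets_def)

lemma generated_sets_mono: "W \<subseteq> W' \<Longrightarrow> generated_sets \<Omega> N X W \<subseteq> generated_sets \<Omega> N X W'"
  by (auto simp: generated_sets_def)

lemma sets_baseline_sigma: "sets (baseline_sigma \<Omega> N X W) = sigma_sets \<Omega> (generated_sets \<Omega> N X W)"
  unfolding baseline_sigma_def by (rule sets_measure_of[OF generated_sets_subset])

lemma space_baseline_sigma [simp]: "space (baseline_sigma \<Omega> N X W) = \<Omega>"
  unfolding baseline_sigma_def by (rule space_measure_of[OF generated_sets_subset])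

locale baseline_variables = prob_space Q
  for Q :: "'a measure" +
  fixes VV :: "'v set" and T :: "'v \<Rightarrow> real" and N :: "'v \<Rightarrow> 'b measure" and X :: "'v \<Rightarrow> 'a \<Rightarrow> 'b"
  assumes finite_VV: "finite VV" and indep: "indep_vars N X VV"
begin

abbreviation "F \<equiv> F0 Q N X"
abbreviation "B \<equiv> baseline_sigma (space Q) N X"
abbreviation "pst \<equiv> past VV T"

lemma X_measurable: "v \<in> VV \<Longrightarrow> X v \<in> Q \<rightarrow>\<^sub>M N v"
  using indep by (auto simp: indep_vars_def)

lemma generators_subset: "generated_sets (space Q) N X W \<union> null_sets Q \<subseteq> Pow (space Q)"
proof -
  have "null_sets Q \<subseteq> Pow (space Q)" using sets.sets_into_space by blast
  then show ?thesis using generated_sets_subset[of "space Q" N X W] by simp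
qed

lemma space_F [simp]: "space (F W) = space Q"
  unfolding F0_def by (rule space_measure_of[OF generators_subset])

lemma sets_F: "sets (F W) = sigma_sets (space Q) (generated_sets (space Q) N X W \<union> null_sets Q)"
  unfolding F0_def by (rule sets_measure_of[OF generators_subset])

lemma generated_sets_events: "W \<subseteq> VV \<Longrightarrow> generated_sets (space Q) N X W \<subseteq> events"
  using X_measurable by (fastforce simp: generated_sets_def intro: measurable_sets)

lemma subalgebra_F: "W \<subseteq> VV \<Longrightarrow> subalgebra Q (F W)"
  unfolding subalgebra_def sets_F
  by (intro conjI sets.sigma_sets_subset Un_least generated_sets_events) auto

lemma F_mono: "W \<subseteq> W' \<Longrightarrow> sets (F W) \<subseteq> sets (F W')"
  unfolding sets_F using generated_sets_mono by (intro sigma_sets_mono') blast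

lemma subalgebra_F_F: "W \<subseteq> W' \<Longrightarrow> subalgebra (F W') (F W)"
  using F_mono by (auto simp: subalgebra_def)

lemma F_measurable_mono: "f \<in> F W \<rightarrow>\<^sub>M M \<Longrightarrow> W \<subseteq> W' \<Longrightarrow> f \<in> F W' \<rightarrow>\<^sub>M M"
  using measurable_from_subalg subalgebra_F_F by blast

lemma F_measurable_Q: "f \<in> F W \<rightarrow>\<^sub>M M \<Longrightarrow> W \<subseteq> VV \<Longrightarrow> f \<in> Q \<rightarrow>\<^sub>M M"
  using measurable_from_subalg subalgebra_F by blast

lemma F_events: "A \<in> sets (F W) \<Longrightarrow> W \<subseteq> VV \<Longrightarrow> A \<in> events"
  using subalgebra_F by (auto simp: subalgebra_def)

lemma null_sets_F: "null_sets Q \<subseteq> sets (F W)"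
  unfolding sets_F by auto

lemma F_agree_mod_null:
  assumes "A \<in> sets (F W)" "agree_mod_null Q A C"
  shows "C \<in> sets (F W)"
proof -
  have "C = (A - (A - C)) \<union> (C - A)" by auto
  then show ?thesis
    using assms null_sets_F[of W] unfolding agree_mod_null_def
    by (metis (no_types, lifting) sets.Diff sets.Un subsetD)
qed

lemma subalgebra_F_B: "subalgebra (F W) (B W)"
  unfolding subalgebra_def sets_F sets_baseline_sigma by (auto intro!: sigma_sets_mono' del: subsetI)

lemma B_events: "A \<in> sets (B W) \<Longrightarrow> W \<subseteq> VV \<Longrightarrow> A \<in> events"
  using subalgebra_F_B[of W] F_events[of A W] by (auto simp: subalgebra_def)

lemma F_approx:
  assumes W: "W \<subseteq> VV" and A: "A \<in> sets (F W)"
  shows "\<exists>C\<in>sets (B W). agree_mod_null Q A C"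
proof -
  have Fev: "C \<in> events" if "C \<in> sigma_sets (space Q) (generated_sets (space Q) N X W \<union> null_sets Q)" for C
    using F_events[OF _ W] that by (simp add: sets_F)
  have "A \<in> sigma_sets (space Q) (generated_sets (space Q) N X W \<union> null_sets Q)"
    using A by (simp add: sets_F)
  then show ?thesis
  proof induction
    case (Basic a)
    then show ?case
    proof
      assume "a \<in> generated_sets (space Q) N X W"
      then show ?thesis by (intro bexI[of _ a]) (auto simp: agree_mod_null_def sets_baseline_sigma)
    qed (auto simp: agree_mod_null_def intro!: bexI[of _ "{}"])
  next
    case Empty
    then show ?case by (auto simp: agree_mod_null_def intro!: bexI[of _ "{}"])
  next
    case (Compl a)
    then obtain C where C: "C \<in> sets (B W)" "agree_mod_null Q a C" by blast
    then show ?case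
      by (intro bexI[of _ "space Q - C"] agree_mod_null_Compl)
         (use B_events[OF _ W] Fev[OF Compl.hyps] sets.compl_sets[of C "B W"] in auto)
  next
    case (Union a)
    then obtain C where C: "\<And>i::nat. C i \<in> sets (B W)" "\<And>i. agree_mod_null Q (a i) (C i)" by metis
    then show ?case
      by (intro bexI[of _ "\<Union>i. C i"] agree_mod_null_UN)
         (use B_events[OF _ W] Fev[OF Union.hyps] in auto)
  qed
qed

text \<open>
  Independence is known for the generated algebras; it survives the adjunction of null sets because
  every event of the completed algebra agrees up to a null set with a generated one.
\<close>

lemma indep_F:
  assumes U: "U \<subseteq> VV" and v: "v \<in> VV" "v \<notin> U"
    and A: "A \<in> sets (F U)" and C: "C \<in> sets (F {v})"
  shows "emeasure Q (A \<inter> C) = emeasure Q A * emeasure Q C"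
proof -
  let ?E = "\<lambda>i. {X i -` A \<inter> space Q |A. A \<in> sets (N i)}"
  have v': "{v} \<subseteq> VV" using v by simp
  have gen: "generated_sets (space Q) N X W = (\<Union>i\<in>W. ?E i)" for W by (simp add: generated_sets_def)
  have "indep_sets (\<lambda>j. sigma_sets (space Q) (\<Union>i\<in>case_bool U {v} j. ?E i)) UNIV"
  proof (rule indep_sets_collect_sigma)
    show "indep_sets ?E (\<Union>j. case_bool U {v} j)"
      by (rule indep_sets_mono_index[of _ VV])
         (use indep U v in \<open>auto simp: indep_vars_def2 split: bool.splits\<close>)
    show "Int_stable (?E i)" for i
    proof (rule Int_stableI)
      fix a b assume "a \<in> ?E i" "b \<in> ?E i"
      then obtain S S' where "S \<in> sets (N i)" "S' \<in> sets (N i)" "a = X i -` S \<inter> space Q" "b = X i -` S' \<inter> space Q"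
        by auto
      then show "a \<inter> b \<in> ?E i" by (auto intro!: exI[of _ "S \<inter> S'"])
    qed
    show "disjoint_family (case_bool U {v})"
      using v by (auto simp: disjoint_family_on_def split: bool.splits)
  qed
  moreover have "(\<lambda>j. sigma_sets (space Q) (\<Union>i\<in>case_bool U {v} j. ?E i)) =
     case_bool (sets (B U)) (sets (B {v}))"
    unfolding sets_baseline_sigma gen by (auto split: bool.splits simp: fun_eq_iff)
  ultimately have ind: "indep_set (sets (B U)) (sets (B {v}))" by (simp add: indep_set_def)
  obtain A' where A': "A' \<in> sets (B U)" "agree_mod_null Q A A'" using F_approx[OF U A] by blast
  obtain C' where C': "C' \<in> sets (B {v})" "agree_mod_null Q C C'" using F_approx[OF v' C] by blast
  have ev: "A \<in> events" "C \<in> events" "A' \<in> events" "C' \<in> events"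
    using F_events[OF A U] F_events[OF C v'] B_events[OF A'(1) U] B_events[OF C'(1) v'] by auto
  have "emeasure Q (A \<inter> C) = emeasure Q (A' \<inter> C')"
    using agree_mod_null_Int[OF A'(2) C'(2)] ev by (intro agree_mod_null_emeasure) auto
  also have "\<dots> = emeasure Q A' * emeasure Q C'"
    using indep_setD[OF ind A'(1) C'(1)] by (simp add: emeasure_eq_measure ennreal_mult)
  also have "\<dots> = emeasure Q A * emeasure Q C"
    using agree_mod_null_emeasure[OF A'(2)] agree_mod_null_emeasure[OF C'(2)] ev by simp
  finally show ?thesis .
qed

lemma indep_F_nn_integral:
  assumes U: "U \<subseteq> VV" and v: "v \<in> VV" "v \<notin> U"
    and f: "f \<in> borel_measurable (F U)" and C: "C \<in> sets (F {v})"
  shows "(\<integral>\<^sup>+\<omega>. indicator C \<omega> * f \<omega> \<partial>Q) = emeasure Q C * integral\<^sup>N Q f"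
proof -
  note sub = subalgebra_F[OF U]
  have Cev: "C \<in> events" by (rule F_events[OF C]) (use v in simp)
  have fQ: "f \<in> borel_measurable Q" by (rule F_measurable_Q[OF f U])
  have "(\<integral>\<^sup>+\<omega>. indicator C \<omega> * f \<omega> \<partial>Q) = integral\<^sup>N (density Q (indicator C)) f"
    using Cev fQ by (subst nn_integral_density) auto
  also have "\<dots> = integral\<^sup>N (scale_measure (emeasure Q C) Q) f"
  proof (rule nn_integral_subalgebra_eqI[OF _ _ _ f])
    fix A assume A: "A \<in> sets (F U)"
    then have "emeasure (density Q (indicator C)) A = emeasure Q (A \<inter> C)"
      using Cev F_events[OF A U] by (simp add: emeasure_restricted Int_commute)
    also have "\<dots> = emeasure (scale_measure (emeasure Q C) Q) A"
      using indep_F[OF U v A C] by (simp add: mult.commute)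
    finally show "emeasure (density Q (indicator C)) A = emeasure (scale_measure (emeasure Q C) Q) A" .
  qed (use sub in \<open>auto simp: subalgebra_def space_scale_measure\<close>)
  also have "\<dots> = emeasure Q C * integral\<^sup>N Q f" using fQ by (rule nn_integral_scale_measure)
  finally show ?thesis .
qed

text \<open>
  The sets of modules that contain the whole past of their members. They matter for two reasons:
  all their \<open>Z v\<close> are measurable with respect to their own information, and the pullback by an action
  does not lead out of this information.
\<close>

definition down_closed :: "'v set \<Rightarrow> bool" where
  "down_closed U \<longleftrightarrow> U \<subseteq> VV \<and> (\<forall>u\<in>U. pst u \<subseteq> U)"

lemma past_subset: "pst v \<subseteq> VV" and past_irrefl: "v \<notin> pst v"
  by (auto simp: past_def)

lemma down_closed_VV: "down_closed VV" and down_closed_past: "down_closed (pst v)"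
  and down_closed_past_insert: "v \<in> VV \<Longrightarrow> down_closed (insert v (pst v))"
  and down_closed_empty: "down_closed {}"
  by (auto simp: down_closed_def past_def)

lemma sets_F_insert:
  "sets (F (insert v W)) = sigma_sets (space Q) {A \<inter> C |A C. A \<in> sets (F W) \<and> C \<in> sets (F {v})}"
    (is "_ = sigma_sets _ ?E")
proof
  have Fsub: "A \<subseteq> space Q" if "A \<in> sets (F W)" for A W using sets.sets_into_space[OF that] by simp
  have inE: "A \<in> ?E" if "A \<in> sets (F W) \<or> A \<in> sets (F {v})" for A
    using that
  proof
    assume "A \<in> sets (F W)"
    then have "A = A \<inter> space Q \<and> A \<in> sets (F W) \<and> space Q \<in> sets (F {v})"
      using Fsub[of A W] sets.top[of "F {v}"] by auto
    then show ?thesis by blast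
  next
    assume "A \<in> sets (F {v})"
    then have "A = space Q \<inter> A \<and> space Q \<in> sets (F W) \<and> A \<in> sets (F {v})"
      using Fsub[of A "{v}"] sets.top[of "F W"] by auto
    then show ?thesis by blast
  qed
  have "generated_sets (space Q) N X (insert v W) \<union> null_sets Q \<subseteq> ?E"
  proof
    fix a assume "a \<in> generated_sets (space Q) N X (insert v W) \<union> null_sets Q"
    then have "a \<in> generated_sets (space Q) N X W \<union> null_sets Q \<or>
        a \<in> generated_sets (space Q) N X {v} \<union> null_sets Q"
      by (auto simp: generated_sets_def)
    then show "a \<in> ?E" by (intro inE) (auto simp: sets_F)
  qed
  then show "sets (F (insert v W)) \<subseteq> sigma_sets (space Q) ?E"
    unfolding sets_F by (intro sigma_sets_mono') 
  have "?E \<subseteq> sets (F (insert v W))"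
    using F_mono[of W "insert v W"] F_mono[of "{v}" "insert v W"] by auto
  then show "sigma_sets (space Q) ?E \<subseteq> sets (F (insert v W))"
    using sets.sigma_sets_subset[of ?E "F (insert v W)"] by simp
qed

end

section \<open>Conditional densities\<close>

locale baseline_densities = baseline_variables Q VV T N X
  for Q :: "'a measure" and VV :: "'v set" and T N and X :: "'v \<Rightarrow> 'a \<Rightarrow> 'b" +
  fixes Z :: "'v \<Rightarrow> 'a \<Rightarrow> real"
  assumes Z_nonneg: "\<And>v \<omega>. v \<in> VV \<Longrightarrow> \<omega> \<in> space Q \<Longrightarrow> 0 \<le> Z v \<omega>"
    and Z_measurable: "\<And>v. v \<in> VV \<Longrightarrow> Z v \<in> borel_measurable (F (pst v \<union> {v}))"
    and Z_cond_exp: "\<And>v. v \<in> VV \<Longrightarrow>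
      AE \<omega> in Q. nn_cond_exp Q (F (pst v)) (\<lambda>\<omega>. ennreal (Z v \<omega>)) \<omega> = 1"
begin

definition zprod :: "'v set \<Rightarrow> 'a \<Rightarrow> ennreal" where
  "zprod W \<omega> = (\<Prod>v\<in>W. ennreal (Z v \<omega>))"

lemma zprod_eq: "W \<subseteq> VV \<Longrightarrow> \<omega> \<in> space Q \<Longrightarrow> ennreal (\<Prod>v\<in>W. Z v \<omega>) = zprod W \<omega>"
  unfolding zprod_def by (rule prod_ennreal[symmetric]) (use Z_nonneg in auto)

lemma Z_measurable_down_closed:
  "down_closed U \<Longrightarrow> v \<in> U \<Longrightarrow> Z v \<in> borel_measurable (F U)"
  by (rule F_measurable_mono[OF Z_measurable]) (auto simp: down_closed_def)

lemma zprod_measurable: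
  "down_closed U \<Longrightarrow> W \<subseteq> U \<Longrightarrow> zprod W \<in> borel_measurable (F U)"
  unfolding zprod_def
  by (intro borel_measurable_prod_ennreal measurable_compose[OF Z_measurable_down_closed measurable_ennreal]) auto

text \<open>
  Bayes' formula for the conditional expectation of \<open>\<eta>\<close> given the past of \<open>v\<close> after the law of \<open>v\<close> given
  its past has been reweighted by \<open>Z v\<close>. The denominator is absent because \<open>Z v\<close> has conditional
  expectation 1. The real version treats positive and negative parts separately, exactly as
  \<^const>\<open>real_cond_exp\<close> is built from \<^const>\<open>nn_cond_exp\<close>.
\<close>

definition bayes_nn :: "'v \<Rightarrow> ('a \<Rightarrow> ennreal) \<Rightarrow> 'a \<Rightarrow> ennreal" where
  "bayes_nn v \<eta> = nn_cond_exp Q (F (pst v)) (\<lambda>\<omega>. \<eta> \<omega> * ennreal (Z v \<omega>))"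

definition bayes :: "'v \<Rightarrow> ('a \<Rightarrow> real) \<Rightarrow> 'a \<Rightarrow> real" where
  "bayes v \<eta> \<omega> =
     enn2real (bayes_nn v (\<lambda>\<omega>. ennreal (\<eta> \<omega>)) \<omega>) - enn2real (bayes_nn v (\<lambda>\<omega>. ennreal (- \<eta> \<omega>)) \<omega>)"

lemma bayes_nn_measurable: "bayes_nn v \<eta> \<in> borel_measurable (F (pst v))"
  unfolding bayes_nn_def by (rule borel_measurable_nn_cond_exp)

lemma bayes_measurable: "bayes v \<eta> \<in> borel_measurable (F (pst v))"
  using bayes_nn_measurable unfolding bayes_def by measurable

lemma nn_integral_factual:
  assumes P: "sets P = events" "absolutely_continuous Q P"
    and RN: "AE \<omega> in Q. RN_deriv (restr_to_subalg Q (F VV)) (restr_to_subalg P (F VV)) \<omega>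
             = ennreal (\<Prod>v\<in>VV. Z v \<omega>)"
    and f: "f \<in> borel_measurable (F VV)"
  shows "integral\<^sup>N P f = (\<integral>\<^sup>+\<omega>. f \<omega> * zprod VV \<omega> \<partial>Q)"
proof -
  let ?Q = "restr_to_subalg Q (F VV)" and ?P = "restr_to_subalg P (F VV)"
  have sub: "subalgebra Q (F VV)" "subalgebra P (F VV)"
    using subalgebra_F[of VV] P(1) sets_eq_imp_space_eq[OF P(1)] by (auto simp: subalgebra_def)
  interpret R: finite_measure ?Q
    by (rule finite_measure_restr_to_subalg[OF sub(1)]) unfold_locales
  have ac: "absolutely_continuous ?Q ?P"
    using P(2) by (auto simp: absolutely_continuous_def null_sets_restr_to_subalg sub)
  let ?D = "RN_deriv ?Q ?P"
  have D: "?D \<in> borel_measurable (F VV)" by (rule measurable_in_subalg'[OF sub(1) borel_measurable_RN_deriv])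
  have "integral\<^sup>N P f = integral\<^sup>N ?P f" by (rule nn_integral_subalgebra2[OF sub(2) f, symmetric])
  also have "\<dots> = (\<integral>\<^sup>+\<omega>. ?D \<omega> * f \<omega> \<partial>?Q)"
    by (rule R.RN_deriv_nn_integral[OF ac])
       (use sub measurable_in_subalg[OF sub(1) f] in \<open>simp_all add: sets_restr_to_subalg\<close>)
  also have "\<dots> = (\<integral>\<^sup>+\<omega>. ?D \<omega> * f \<omega> \<partial>Q)"
    by (rule nn_integral_subalgebra2[OF sub(1)]) (use D f in auto)
  also have "\<dots> = (\<integral>\<^sup>+\<omega>. f \<omega> * zprod VV \<omega> \<partial>Q)"
  proof (rule nn_integral_cong_AE)
    show "AE \<omega> in Q. ?D \<omega> * f \<omega> = f \<omega> * zprod VV \<omega>"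
      using RN AE_space by eventually_elim (simp add: zprod_eq mult.commute)
  qed
  finally show ?thesis .
qed

end

section \<open>Pulling baseline information back along an action\<close>

locale baseline_intervention = baseline_densities Q VV T N X Z
  for Q :: "'a measure" and VV :: "'v set" and T N and X :: "'v \<Rightarrow> 'a \<Rightarrow> 'b" and Z +
  fixes \<A> :: "'v set" and \<theta> :: "'a \<Rightarrow> 'a"
  assumes A_subset: "\<A> \<subseteq> VV" and action: "baseline_action VV T N X Q \<A> \<theta>"
begin

lemma theta_measurable [measurable]: "\<theta> \<in> Q \<rightarrow>\<^sub>M Q"
  using action by (simp add: baseline_action_def)

lemma AE_theta:
  assumes "AE \<omega> in Q. \<phi> \<omega>"
  shows "AE \<omega> in Q. \<phi> (\<theta> \<omega>)"
proof (rule AE_distrD[OF theta_measurable])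
  show "AE \<omega> in distr Q Q \<theta>. \<phi> \<omega>"
    by (rule absolutely_continuous_AE[OF _ _ assms]) (use action in \<open>auto simp: baseline_action_def\<close>)
qed

lemma null_sets_theta: "A \<in> null_sets Q \<Longrightarrow> \<theta> -` A \<inter> space Q \<in> null_sets Q"
  using AE_theta[OF AE_not_in, of A] measurable_sets[OF theta_measurable, of A]
  by (subst AE_iff_null_sets) (auto elim: eventually_mono)

lemma vimage_theta_events: "A \<in> events \<Longrightarrow> \<theta> -` A \<inter> space Q \<in> events"
  by (rule measurable_sets[OF theta_measurable])

lemma generator_in_F: "v \<in> W \<Longrightarrow> S \<in> sets (N v) \<Longrightarrow> X v -` S \<inter> space Q \<in> sets (F W)"
  unfolding sets_F by (intro sigma_sets.Basic) (auto simp: generated_sets_def)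

text \<open>
  The hypothesis on actions gives invariance for one module at a time. The sets that are invariant up
  to a null set form a sigma-algebra, so invariance extends to joint information; null sets are
  covered because \<open>\<theta>\<close> pulls them back to null sets.
\<close>

lemma vimage_theta_invariant:
  assumes W: "W \<subseteq> VV - \<A>" and A: "A \<in> sets (F W)"
  shows "agree_mod_null Q (\<theta> -` A \<inter> space Q) A"
proof -
  have W': "W \<subseteq> VV" using W by auto
  have ev: "C \<in> events" if "C \<in> sigma_sets (space Q) (generated_sets (space Q) N X W \<union> null_sets Q)" for C
    using F_events[OF _ W'] that by (simp add: sets_F)
  have "A \<in> sigma_sets (space Q) (generated_sets (space Q) N X W \<union> null_sets Q)"
    using A by (simp add: sets_F)
  then show ?thesis
  proof induction
    case (Basic a)
    then show ?case
    proof
      assume "a \<in> generated_sets (space Q) N X W"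
      then obtain v S where v: "v \<in> W" "S \<in> sets (N v)" and a: "a = X v -` S \<inter> space Q"
        by (auto simp: generated_sets_def)
      have aF: "a \<in> sets (F {v})" unfolding a by (rule generator_in_F) (use v in auto)
      have "v \<in> VV - \<A>" using v W by auto
      moreover have "indicat_real a \<in> borel_measurable (F {v})" using aF by simp
      ultimately have "AE \<omega> in Q. indicat_real a (\<theta> \<omega>) = indicat_real a \<omega>"
        using action unfolding baseline_action_def by blast
      then have "AE \<omega> in Q. \<omega> \<in> \<theta> -` a \<inter> space Q \<longleftrightarrow> \<omega> \<in> a"
        using AE_space by eventually_elim (auto simp: indicator_def split: if_splits)
      then show ?thesis
        using F_events[OF aF] v W' by (intro AE_agree_mod_null vimage_theta_events) auto
    next
      assume a: "a \<in> null_sets Q"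
      show ?thesis
        by (rule agree_mod_null_mono[where C = "(\<theta> -` a \<inter> space Q) \<union> a"])
           (use a null_sets_theta[OF a] in auto)
    qed
  next
    case Empty
    then show ?case by (simp add: agree_mod_null_def)
  next
    case (Compl a)
    have eq: "\<theta> -` (space Q - a) \<inter> space Q = space Q - (\<theta> -` a \<inter> space Q)"
      using measurable_space[OF theta_measurable] by auto
    show ?case
      unfolding eq
      by (intro agree_mod_null_Compl Compl.IH vimage_theta_events ev[OF Compl.hyps])
  next
    case (Union a)
    have eq: "\<theta> -` (\<Union>i. a i) \<inter> space Q = (\<Union>i. \<theta> -` a i \<inter> space Q)" by auto
    show ?case
      unfolding eq
      by (intro agree_mod_null_UN Union.IH vimage_theta_events ev[OF Union.hyps])
  qed
qed

text \<open>
  Two real numbers that lie below the same rationals are equal, so countably many sublevel sets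
  suffice to pass from events to functions.
\<close>

lemma comp_theta_invariant:
  fixes f :: "'a \<Rightarrow> real"
  assumes W: "W \<subseteq> VV - \<A>" and f: "f \<in> borel_measurable (F W)"
  shows "AE \<omega> in Q. f (\<theta> \<omega>) = f \<omega>"
proof -
  have "AE \<omega> in Q. f (\<theta> \<omega>) < q \<longleftrightarrow> f \<omega> < q" for q
  proof -
    have "{\<omega> \<in> space (F W). f \<omega> < q} \<in> sets (F W)" using f by measurable
    then have "agree_mod_null Q (\<theta> -` {\<omega> \<in> space Q. f \<omega> < q} \<inter> space Q) {\<omega> \<in> space Q. f \<omega> < q}"
      by (intro vimage_theta_invariant[OF W]) simp
    from agree_mod_null_AE[OF this] show ?thesis
      using AE_space by eventually_elim (use measurable_space[OF theta_measurable] in auto)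
  qed
  then have "AE \<omega> in Q. \<forall>q\<in>\<rat>. f (\<theta> \<omega>) < q \<longleftrightarrow> f \<omega> < q"
    by (subst AE_ball_countable) (auto intro: countable_rat)
  then show ?thesis
  proof eventually_elim
    case (elim \<omega>)
    show ?case
    proof (rule ccontr)
      assume "f (\<theta> \<omega>) \<noteq> f \<omega>"
      then consider "f (\<theta> \<omega>) < f \<omega>" | "f \<omega> < f (\<theta> \<omega>)" by linarith
      then show False
        using elim by cases (metis Rats_dense_in_real less_asym)+
    qed
  qed
qed

text \<open>
  A function of an intervened \<open>v\<close> is pulled back to a function of the non-intervened part of the past
  of \<open>v\<close>, which lies in \<open>U\<close> because \<open>U\<close> is closed under predecessors; a function of a non-intervened
  module stays with that module.
\<close>

lemma theta_measurable_F:
  assumes U: "down_closed U"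
  shows "\<theta> \<in> F (U - \<A>) \<rightarrow>\<^sub>M F U"
  unfolding F0_def[of Q N X U]
proof (rule measurable_measure_of)
  show "generated_sets (space Q) N X U \<union> null_sets Q \<subseteq> Pow (space Q)" by (rule generators_subset)
  show "\<theta> \<in> space (F (U - \<A>)) \<rightarrow> space Q" using measurable_space[OF theta_measurable] by auto
  fix a assume "a \<in> generated_sets (space Q) N X U \<union> null_sets Q"
  then have "\<theta> -` a \<inter> space Q \<in> sets (F (U - \<A>))"
  proof
    assume "a \<in> null_sets Q"
    then show ?thesis using null_sets_theta null_sets_F by blast
  next
    assume "a \<in> generated_sets (space Q) N X U"
    then obtain v S where v: "v \<in> U" "S \<in> sets (N v)" and a: "a = X v -` S \<inter> space Q"
      by (auto simp: generated_sets_def)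
    have vV: "v \<in> VV" "pst v \<subseteq> U" using v U by (auto simp: down_closed_def)
    have aF: "a \<in> sets (F {v})" unfolding a by (rule generator_in_F) (use v in auto)
    show ?thesis
    proof (cases "v \<in> \<A>")
      case True
      have "indicat_real a \<in> borel_measurable (F {v})" using aF by simp
      then have *: "(\<lambda>\<omega>. indicat_real a (\<theta> \<omega>)) \<in> borel_measurable (F (pst v \<inter> (VV - \<A>)))"
        using action True unfolding baseline_action_def by blast
      have "{\<omega> \<in> space (F (pst v \<inter> (VV - \<A>))). indicat_real a (\<theta> \<omega>) = 1} \<in> sets (F (pst v \<inter> (VV - \<A>)))"
        using * by measurable
      also have "{\<omega> \<in> space (F (pst v \<inter> (VV - \<A>))). indicat_real a (\<theta> \<omega>) = 1} = \<theta> -` a \<inter> space Q"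
        by (auto simp: indicator_def)
      finally show ?thesis using F_mono[of "pst v \<inter> (VV - \<A>)" "U - \<A>"] vV by auto
    next
      case False
      then have "{v} \<subseteq> VV - \<A>" "{v} \<subseteq> U - \<A>" using vV v by auto
      then show ?thesis
        using F_agree_mod_null[OF aF agree_mod_null_sym[OF vimage_theta_invariant[OF _ aF]]]
          F_mono[of "{v}" "U - \<A>"] by blast
    qed
  qed
  then show "\<theta> -` a \<inter> space (F (U - \<A>)) \<in> sets (F (U - \<A>))" by simp
qed

lemma comp_theta_measurable:
  assumes "down_closed U" "f \<in> F U \<rightarrow>\<^sub>M M"
  shows "(\<lambda>\<omega>. f (\<theta> \<omega>)) \<in> F (U - \<A>) \<rightarrow>\<^sub>M M"
  using measurable_compose[OF theta_measurable_F[OF assms(1)] assms(2)] .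

section \<open>Conditioning on the past commutes with the action\<close>

text \<open>
  Restrict \<open>Q\<close> to an event \<open>S\<close> that does not involve \<open>v\<close>, and take the image under \<open>\<theta>\<close>. On the past of \<open>v\<close>
  the image has some density \<open>k\<close>. The module \<open>v\<close> is unmoved by \<open>\<theta>\<close> and independent of \<open>S\<close> and of the
  pulled-back past, so under the image measure (after normalisation) it still has its old law and is
  still independent of the past; hence \<open>k\<close> remains a density when \<open>v\<close> is joined to the past. A density that sees only the
  past can be paired with a conditional expectation given the past.
\<close>

lemma past_measurable_density_of_image:
  assumes v: "v \<in> VV" "v \<notin> \<A>" and U: "U \<subseteq> VV" "v \<notin> U" "pst v \<subseteq> U"
    and S: "S \<in> sets (F U)"
  obtains k where "k \<in> borel_measurable (F (pst v))"
    and "\<And>g. g \<in> borel_measurable (F (insert v (pst v))) \<Longrightarrow>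
      (\<integral>\<^sup>+\<omega>. indicator S \<omega> * g (\<theta> \<omega>) \<partial>Q) = (\<integral>\<^sup>+\<omega>. k \<omega> * g \<omega> \<partial>Q)"
proof -
  let ?P = "F (pst v)" and ?PV = "F (insert v (pst v))"
  have Sev: "S \<in> events" by (rule F_events[OF S U(1)])
  have PVV: "insert v (pst v) \<subseteq> VV" using v past_subset by auto
  define \<mu> where "\<mu> = distr (density Q (indicator S)) Q \<theta>"
  have sets_mu [simp]: "sets \<mu> = events" "space \<mu> = space Q" by (simp_all add: \<mu>_def)
  have mu: "emeasure \<mu> C = emeasure Q (S \<inter> (\<theta> -` C \<inter> space Q))" if "C \<in> events" for C
    unfolding \<mu>_def using that Sev vimage_theta_events[OF that]
    by (subst emeasure_distr) (auto simp: emeasure_restricted)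
  have sub: "subalgebra Q ?P" "subalgebra \<mu> ?P" "subalgebra Q ?PV" "subalgebra \<mu> ?PV"
    using subalgebra_F[OF past_subset] subalgebra_F[OF PVV] by (auto simp: subalgebra_def)
  interpret QP: finite_measure "restr_to_subalg Q ?P"
    by (rule finite_measure_restr_to_subalg[OF sub(1)]) unfold_locales
  have "absolutely_continuous (restr_to_subalg Q ?P) (restr_to_subalg \<mu> ?P)"
    unfolding absolutely_continuous_def null_sets_restr_to_subalg[OF sub(1)] null_sets_restr_to_subalg[OF sub(2)]
  proof (intro Int_mono subsetI)
    fix C assume C: "C \<in> null_sets Q"
    have "emeasure \<mu> C \<le> emeasure Q (\<theta> -` C \<inter> space Q)"
      using C mu[of C] by (auto intro!: emeasure_mono vimage_theta_events)
    then show "C \<in> null_sets \<mu>" using null_sets_theta[OF C] C by (auto simp: null_sets_def)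
  qed auto
  from QP.Radon_Nikodym[OF this] obtain k
    where k_restr: "k \<in> borel_measurable (restr_to_subalg Q ?P)"
      and dk: "density (restr_to_subalg Q ?P) k = restr_to_subalg \<mu> ?P"
    unfolding sets_restr_to_subalg[OF sub(1)] sets_restr_to_subalg[OF sub(2)] by blast
  have k: "k \<in> borel_measurable ?P" by (rule measurable_in_subalg'[OF sub(1) k_restr])
  have kQ: "k \<in> borel_measurable Q" by (rule F_measurable_Q[OF k past_subset])
  have k_past: "(\<integral>\<^sup>+\<omega>. k \<omega> * indicator A \<omega> \<partial>Q) = emeasure \<mu> A" if A: "A \<in> sets ?P" for A
  proof -
    have "emeasure \<mu> A = emeasure (restr_to_subalg \<mu> ?P) A"
      by (rule emeasure_restr_to_subalg[OF sub(2) A, symmetric])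
    also have "\<dots> = (\<integral>\<^sup>+\<omega>. k \<omega> * indicator A \<omega> \<partial>restr_to_subalg Q ?P)"
      unfolding dk[symmetric]
      by (rule emeasure_density) (use A k_restr sub(1) in \<open>auto simp: sets_restr_to_subalg\<close>)
    also have "\<dots> = (\<integral>\<^sup>+\<omega>. k \<omega> * indicator A \<omega> \<partial>Q)"
      by (rule nn_integral_subalgebra2[OF sub(1)]) (use A k in auto)
    finally show ?thesis by simp
  qed
  let ?E = "{A \<inter> C |A C. A \<in> sets ?P \<and> C \<in> sets (F {v})}"
  have "restr_to_subalg \<mu> ?PV = restr_to_subalg (density Q k) ?PV"
  proof (rule measure_eqI_generator_eq[where E = ?E and \<Omega> = "space Q" and A = "\<lambda>_. space Q"])
    show "Int_stable ?E"
    proof (rule Int_stableI)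
      fix a b assume "a \<in> ?E" "b \<in> ?E"
      then obtain A C A' C' where *: "a = A \<inter> C" "b = A' \<inter> C'"
        "A \<in> sets ?P" "A' \<in> sets ?P" "C \<in> sets (F {v})" "C' \<in> sets (F {v})" by blast
      have "a \<inter> b = (A \<inter> A') \<inter> (C \<inter> C')" "A \<inter> A' \<in> sets ?P" "C \<inter> C' \<in> sets (F {v})" using * by auto
      then show "a \<inter> b \<in> ?E" unfolding mem_Collect_eq by (intro exI conjI)
    qed
    have "a \<subseteq> space Q" if aE: "a \<in> ?E" for a
    proof -
      obtain A C where "a = A \<inter> C" "A \<in> sets ?P" using aE by blast
      then show ?thesis using sets.sets_into_space[of A ?P] by auto
    qed
    then show "?E \<subseteq> Pow (space Q)" by blast
    have subd: "subalgebra (density Q k) ?PV" using sub(3) by (auto simp: subalgebra_def)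
    show "sets (restr_to_subalg \<mu> ?PV) = sigma_sets (space Q) ?E"
      "sets (restr_to_subalg (density Q k) ?PV) = sigma_sets (space Q) ?E"
      unfolding sets_restr_to_subalg[OF sub(4)] sets_restr_to_subalg[OF subd] by (rule sets_F_insert)+
    have "space Q \<in> sets ?P" "space Q \<in> sets (F {v})"
      using sets.top[of ?P] sets.top[of "F {v}"] by simp_all
    then show "range (\<lambda>_::nat. space Q) \<subseteq> ?E" by (auto intro!: exI[of _ "space Q"])
    show "emeasure (restr_to_subalg \<mu> ?PV) (space Q) \<noteq> \<infinity>"
      using emeasure_restr_to_subalg[OF sub(4), of "space Q"] sets.top[of ?PV] by (simp add: mu)
    fix a assume aE: "a \<in> ?E"
    then obtain A C where a: "a = A \<inter> C" and A: "A \<in> sets ?P" and C: "C \<in> sets (F {v})" by blast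
    have aPV: "a \<in> sets ?PV" unfolding sets_F_insert[of v "pst v"] using aE by (rule sigma_sets.Basic)
    have ev: "A \<in> events" "C \<in> events" "a \<in> events"
      using F_events[OF A past_subset] F_events[OF C] F_events[OF aPV PVV] v by auto
    let ?A = "\<theta> -` A \<inter> space Q" and ?C = "\<theta> -` C \<inter> space Q"
    have "?A \<in> sets (F (pst v - \<A>))"
      using measurable_sets[OF theta_measurable_F[OF down_closed_past] A] by simp
    then have "?A \<in> sets (F U)" using F_mono[of "pst v - \<A>" U] U by blast
    then have SA: "S \<inter> ?A \<in> sets (F U)" using S by auto
    have evA: "S \<inter> ?A \<in> events" and evC: "?C \<in> events"
      using F_events[OF SA U(1)] vimage_theta_events[OF ev(2)] by auto
    have "emeasure (restr_to_subalg \<mu> ?PV) a = emeasure Q (S \<inter> (\<theta> -` a \<inter> space Q))"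
      by (simp add: emeasure_restr_to_subalg[OF sub(4) aPV] mu ev)
    also have "S \<inter> (\<theta> -` a \<inter> space Q) = (S \<inter> ?A) \<inter> ?C" unfolding a by auto
    \<comment> \<open>The action does not move \<open>v\<close>; afterwards \<open>C\<close> splits off by independence.\<close>
    also have "emeasure Q ((S \<inter> ?A) \<inter> ?C) = emeasure Q ((S \<inter> ?A) \<inter> C)"
    proof (rule agree_mod_null_emeasure)
      have "agree_mod_null Q ?C C" by (rule vimage_theta_invariant[OF _ C]) (use v in auto)
      then show "agree_mod_null Q ((S \<inter> ?A) \<inter> ?C) ((S \<inter> ?A) \<inter> C)"
        by (rule agree_mod_null_Int[OF _ _ evA evC evA ev(2), rotated]) (simp add: agree_mod_null_def)
    qed (use ev evA evC in simp_all)
    also have "\<dots> = emeasure Q (S \<inter> ?A) * emeasure Q C" by (rule indep_F[OF U(1) v(1) U(2) SA C])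
    also have "\<dots> = emeasure Q C * (\<integral>\<^sup>+\<omega>. k \<omega> * indicator A \<omega> \<partial>Q)"
      using k_past[OF A] mu[OF ev(1)] by (simp add: mult.commute)
    also have "\<dots> = (\<integral>\<^sup>+\<omega>. indicator C \<omega> * (k \<omega> * indicator A \<omega>) \<partial>Q)"
      by (rule indep_F_nn_integral[OF past_subset v(1) past_irrefl _ C, symmetric]) (use k A in auto)
    also have "\<dots> = (\<integral>\<^sup>+\<omega>. k \<omega> * indicator a \<omega> \<partial>Q)"
      by (intro nn_integral_cong) (auto simp: a indicator_def)
    also have "\<dots> = emeasure (density Q k) a" by (rule emeasure_density[symmetric]) (use kQ ev in auto)
    also have "\<dots> = emeasure (restr_to_subalg (density Q k) ?PV) a"
      by (rule emeasure_restr_to_subalg[OF subd aPV, symmetric])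
    finally show "emeasure (restr_to_subalg \<mu> ?PV) a = emeasure (restr_to_subalg (density Q k) ?PV) a" .
  qed auto
  note eq = this
  have subd: "subalgebra (density Q k) ?PV" using sub(3) by (auto simp: subalgebra_def)
  show thesis
  proof (rule that[OF k])
    fix g :: "'a \<Rightarrow> ennreal" assume g: "g \<in> borel_measurable ?PV"
    have gQ [measurable]: "g \<in> borel_measurable Q" by (rule F_measurable_Q[OF g PVV])
    have "(\<integral>\<^sup>+\<omega>. indicator S \<omega> * g (\<theta> \<omega>) \<partial>Q) = integral\<^sup>N \<mu> g"
      unfolding \<mu>_def using Sev gQ theta_measurable
      by (subst nn_integral_distr; (subst nn_integral_density)?; auto intro: measurable_compose)
    also have "\<dots> = integral\<^sup>N (density Q k) g"
      using nn_integral_subalgebra2[OF sub(4) g] nn_integral_subalgebra2[OF subd g] eq by simp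
    also have "\<dots> = (\<integral>\<^sup>+\<omega>. k \<omega> * g \<omega> \<partial>Q)" by (rule nn_integral_density) (use kQ gQ in auto)
    finally show "(\<integral>\<^sup>+\<omega>. indicator S \<omega> * g (\<theta> \<omega>) \<partial>Q) = (\<integral>\<^sup>+\<omega>. k \<omega> * g \<omega> \<partial>Q)" .
  qed
qed

text \<open>
  In terms of conditional expectations: \<open>E\<^sub>Q[g \<circ> \<theta> | F U] = E\<^sub>Q[g | past of v] \<circ> \<theta>\<close>. Allowing \<open>U\<close> to be
  larger than the past of \<open>v\<close>, as long as it omits \<open>v\<close>, is what later yields independence of the
  contemporaneous modules. With \<open>g \<circ> \<theta>\<close> and its candidate conditional expectation taken as densities
  with respect to \<open>Q\<close>, two measures have to agree on \<open>F U\<close>.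
\<close>

lemma cond_exp_comp_theta:
  assumes v: "v \<in> VV" "v \<notin> \<A>" and U: "U \<subseteq> VV" "v \<notin> U" "pst v \<subseteq> U"
    and H: "H \<in> borel_measurable (F U)" and g: "g \<in> borel_measurable (F (insert v (pst v)))"
  shows "(\<integral>\<^sup>+\<omega>. H \<omega> * g (\<theta> \<omega>) \<partial>Q) = (\<integral>\<^sup>+\<omega>. H \<omega> * nn_cond_exp Q (F (pst v)) g (\<theta> \<omega>) \<partial>Q)"
proof -
  let ?m = "nn_cond_exp Q (F (pst v)) g"
  note sub = subalgebra_F[OF past_subset, of v]
  interpret P: finite_measure_subalgebra Q "F (pst v)" by unfold_locales (rule sub)
  have PVV: "insert v (pst v) \<subseteq> VV" using v past_subset by auto
  have gQ: "g \<in> borel_measurable Q" by (rule F_measurable_Q[OF g PVV])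
  have m: "?m \<in> borel_measurable (F (insert v (pst v)))"
    by (rule F_measurable_mono[OF borel_measurable_nn_cond_exp]) auto
  have mQ: "?m \<in> borel_measurable Q" by (rule F_measurable_Q[OF m PVV])
  have dens: "(\<integral>\<^sup>+\<omega>. H \<omega> * f (\<theta> \<omega>) \<partial>Q) = integral\<^sup>N (density Q (\<lambda>\<omega>. f (\<theta> \<omega>))) H"
    if "f \<in> borel_measurable Q" for f
    using that F_measurable_Q[OF H U(1)] measurable_compose[OF theta_measurable that]
    by (subst nn_integral_density) (auto simp: mult.commute)
  have "integral\<^sup>N (density Q (\<lambda>\<omega>. g (\<theta> \<omega>))) H = integral\<^sup>N (density Q (\<lambda>\<omega>. ?m (\<theta> \<omega>))) H"
  proof (rule nn_integral_subalgebra_eqI[OF _ _ _ H])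
    fix S assume S: "S \<in> sets (F U)"
    obtain k where k: "k \<in> borel_measurable (F (pst v))"
      and kg: "\<And>g. g \<in> borel_measurable (F (insert v (pst v))) \<Longrightarrow>
        (\<integral>\<^sup>+\<omega>. indicator S \<omega> * g (\<theta> \<omega>) \<partial>Q) = (\<integral>\<^sup>+\<omega>. k \<omega> * g \<omega> \<partial>Q)"
      using past_measurable_density_of_image[OF v U S] by blast
    have em: "emeasure (density Q (\<lambda>\<omega>. f (\<theta> \<omega>))) S = (\<integral>\<^sup>+\<omega>. indicator S \<omega> * f (\<theta> \<omega>) \<partial>Q)"
      if "f \<in> borel_measurable Q" for f
      using that F_events[OF S U(1)] measurable_compose[OF theta_measurable that]
      by (subst emeasure_density) (auto simp: mult.commute)
    show "emeasure (density Q (\<lambda>\<omega>. g (\<theta> \<omega>))) S = emeasure (density Q (\<lambda>\<omega>. ?m (\<theta> \<omega>))) S"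
      unfolding em[OF gQ] em[OF mQ] kg[OF g] kg[OF m]
      by (rule P.nn_cond_exp_intg[OF k gQ, symmetric])
  qed (use subalgebra_F[OF U(1)] in \<open>auto simp: subalgebra_def\<close>)
  then show ?thesis unfolding dens[OF gQ] dens[OF mQ] .
qed

text \<open>
  The densities outside \<open>U\<close> are removed one at a time. Removing a module of maximal time keeps the
  remaining set closed under predecessors, and then the removed \<open>Z v\<close> contributes only its conditional
  expectation 1.
\<close>

lemma nn_integral_drop_later_densities:
  assumes U: "down_closed U" and U': "down_closed U'" "U \<subseteq> U'"
    and f: "f \<in> borel_measurable (F U)"
  shows "(\<integral>\<^sup>+\<omega>. f (\<theta> \<omega>) * zprod (U' - \<A>) (\<theta> \<omega>) \<partial>Q) = (\<integral>\<^sup>+\<omega>. f (\<theta> \<omega>) * zprod (U - \<A>) (\<theta> \<omega>) \<partial>Q)"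
  using U'
proof (induction "card (U' - U)" arbitrary: U' rule: less_induct)
  case less
  show ?case
  proof (cases "U' = U")
    case False
    have sub: "U' \<subseteq> VV" using less.prems by (simp add: down_closed_def)
    have fin: "finite (U' - U)" using sub finite_VV finite_subset by blast
    have "Max (T ` (U' - U)) \<in> T ` (U' - U)" using False less.prems fin by (intro Max_in) auto
    then obtain v where v: "v \<in> U'" "v \<notin> U" and max: "T v = Max (T ` (U' - U))" by auto
    have le: "T w \<le> T v" if "w \<in> U' - U" for w unfolding max using fin that by auto
    define W where "W = U' - {v}"
    have W: "W \<subseteq> VV" "v \<notin> W" "U \<subseteq> W" using sub v less.prems by (auto simp: W_def)
    have dW: "down_closed W"
      unfolding down_closed_def
    proof (intro conjI ballI W)
      fix u assume u: "u \<in> W"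
      then have "pst u \<subseteq> U'" using less.prems by (auto simp: W_def down_closed_def)
      moreover have "v \<notin> pst u"
      proof (cases "u \<in> U")
        case True
        then show ?thesis using U v by (auto simp: down_closed_def)
      next
        case False
        then show ?thesis using le[of u] u by (auto simp: W_def past_def)
      qed
      ultimately show "pst u \<subseteq> W" by (auto simp: W_def)
    qed
    have pW: "pst v \<subseteq> W" using less.prems v past_irrefl[of v] by (auto simp: W_def down_closed_def)
    have "U' - U = insert v (W - U)" "v \<notin> W - U" using v by (auto simp: W_def)
    then have "card (W - U) < card (U' - U)" using fin by simp
    note IH = less.hyps[OF this dW W(3)]
    show ?thesis
    proof (cases "v \<in> \<A>")
      case True
      then have "U' - \<A> = W - \<A>" by (auto simp: W_def)
      then show ?thesis using IH by simp
    next
      case False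
      let ?z = "\<lambda>\<omega>. ennreal (Z v \<omega>)"
      let ?H = "\<lambda>\<omega>. f (\<theta> \<omega>) * zprod (W - \<A>) (\<theta> \<omega>)"
      have vV: "v \<in> VV" using v sub by auto
      have "U' - \<A> = insert v (W - \<A>)" using False v by (auto simp: W_def)
      moreover have "finite (W - \<A>)" using W finite_VV finite_subset by blast
      ultimately have split: "zprod (U' - \<A>) \<omega> = ?z \<omega> * zprod (W - \<A>) \<omega>" for \<omega>
        using W unfolding zprod_def by simp
      have "(\<lambda>\<omega>. f \<omega> * zprod (W - \<A>) \<omega>) \<in> borel_measurable (F W)"
        using F_measurable_mono[OF f W(3)] zprod_measurable[OF dW, of "W - \<A>"] by auto
      then have H: "?H \<in> borel_measurable (F W)"
        by (intro F_measurable_mono[OF comp_theta_measurable[OF dW]]) auto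
      have z: "?z \<in> borel_measurable (F (insert v (pst v)))"
        using Z_measurable[OF vV] by simp
      have "(\<integral>\<^sup>+\<omega>. f (\<theta> \<omega>) * zprod (U' - \<A>) (\<theta> \<omega>) \<partial>Q) = (\<integral>\<^sup>+\<omega>. ?H \<omega> * ?z (\<theta> \<omega>) \<partial>Q)"
        unfolding split by (intro nn_integral_cong) (simp add: mult_ac)
      also have "\<dots> = (\<integral>\<^sup>+\<omega>. ?H \<omega> * nn_cond_exp Q (F (pst v)) ?z (\<theta> \<omega>) \<partial>Q)"
        by (rule cond_exp_comp_theta[OF vV False W(1,2) pW H z])
      also have "\<dots> = (\<integral>\<^sup>+\<omega>. ?H \<omega> \<partial>Q)"
        using AE_theta[OF Z_cond_exp[OF vV]] by (intro nn_integral_cong_AE) (elim eventually_mono, simp)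
      finally show ?thesis using IH by simp
    qed
  qed simp
qed

section \<open>Bayes' formula for reweighted images\<close>

text \<open>
  Drop the densities later than \<open>v\<close>, replace \<open>\<eta> * Z v\<close> by its conditional expectation given the past,
  which no longer involves \<open>v\<close>, and restore all the densities.
\<close>

lemma nn_integral_bayes:
  assumes v: "v \<in> VV" "v \<notin> \<A>" and U: "down_closed U" "down_closed (insert v U)" "v \<notin> U"
    and h: "h \<in> borel_measurable (F U)" and \<eta>: "\<eta> \<in> borel_measurable (F {v})"
  shows "(\<integral>\<^sup>+\<omega>. h (\<theta> \<omega>) * \<eta> (\<theta> \<omega>) * zprod (VV - \<A>) (\<theta> \<omega>) \<partial>Q) =
    (\<integral>\<^sup>+\<omega>. h (\<theta> \<omega>) * bayes_nn v \<eta> (\<theta> \<omega>) * zprod (VV - \<A>) (\<theta> \<omega>) \<partial>Q)"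
proof -
  have UV: "U \<subseteq> VV" "insert v U \<subseteq> VV" using U by (auto simp: down_closed_def)
  have pU: "pst v \<subseteq> U" using U past_irrefl[of v] by (auto simp: down_closed_def)
  let ?z = "\<lambda>\<omega>. ennreal (Z v \<omega>)"
  let ?H = "\<lambda>\<omega>. h (\<theta> \<omega>) * zprod (U - \<A>) (\<theta> \<omega>)"
  have "insert v U - \<A> = insert v (U - \<A>)" "finite (U - \<A>)" "v \<notin> U - \<A>"
    using v U UV finite_VV finite_subset[of "U - \<A>" VV] by auto
  then have split: "zprod (insert v U - \<A>) \<omega> = ?z \<omega> * zprod (U - \<A>) \<omega>" for \<omega>
    unfolding zprod_def by simp
  have hz: "(\<lambda>\<omega>. h \<omega> * zprod (U - \<A>) \<omega>) \<in> borel_measurable (F U)"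
    using h zprod_measurable[OF U(1), of "U - \<A>"] by auto
  have H: "?H \<in> borel_measurable (F U)"
    by (rule F_measurable_mono[OF comp_theta_measurable[OF U(1) hz]]) auto
  have "?z \<in> borel_measurable (F (insert v (pst v)))"
    using Z_measurable[OF v(1)] by simp
  then have g: "(\<lambda>\<omega>. \<eta> \<omega> * ?z \<omega>) \<in> borel_measurable (F (insert v (pst v)))"
    using F_measurable_mono[OF \<eta>, of "insert v (pst v)"] by auto
  have h\<eta>: "(\<lambda>\<omega>. h \<omega> * \<eta> \<omega>) \<in> borel_measurable (F (insert v U))"
    using F_measurable_mono[OF h subset_insertI] F_measurable_mono[OF \<eta>, of "insert v U"] by auto
  have hm: "(\<lambda>\<omega>. h \<omega> * bayes_nn v \<eta> \<omega>) \<in> borel_measurable (F U)"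
    using h F_measurable_mono[OF bayes_nn_measurable pU] by auto
  have "(\<integral>\<^sup>+\<omega>. h (\<theta> \<omega>) * \<eta> (\<theta> \<omega>) * zprod (VV - \<A>) (\<theta> \<omega>) \<partial>Q) =
      (\<integral>\<^sup>+\<omega>. h (\<theta> \<omega>) * \<eta> (\<theta> \<omega>) * zprod (insert v U - \<A>) (\<theta> \<omega>) \<partial>Q)"
    by (rule nn_integral_drop_later_densities[OF U(2) down_closed_VV UV(2) h\<eta>])
  also have "\<dots> = (\<integral>\<^sup>+\<omega>. ?H \<omega> * (\<lambda>\<omega>. \<eta> \<omega> * ?z \<omega>) (\<theta> \<omega>) \<partial>Q)"
    unfolding split by (intro nn_integral_cong) (simp add: mult_ac)
  also have "\<dots> = (\<integral>\<^sup>+\<omega>. ?H \<omega> * bayes_nn v \<eta> (\<theta> \<omega>) \<partial>Q)"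
    unfolding bayes_nn_def by (rule cond_exp_comp_theta[OF v UV(1) U(3) pU H g])
  also have "\<dots> = (\<integral>\<^sup>+\<omega>. h (\<theta> \<omega>) * bayes_nn v \<eta> (\<theta> \<omega>) * zprod (U - \<A>) (\<theta> \<omega>) \<partial>Q)"
    by (intro nn_integral_cong) (simp add: mult_ac)
  also have "\<dots> = (\<integral>\<^sup>+\<omega>. h (\<theta> \<omega>) * bayes_nn v \<eta> (\<theta> \<omega>) * zprod (VV - \<A>) (\<theta> \<omega>) \<partial>Q)"
    by (rule nn_integral_drop_later_densities[OF U(1) down_closed_VV UV(1) hm, symmetric])
  finally show ?thesis .
qed

text \<open>
  The measure \<open>M\<close> is described only through its integrals, so that the lemma applies to the
  counterfactual measure and also, with the identity as action, to the factual one. The latter lives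
  on a larger sigma-algebra.
\<close>

lemma real_cond_exp_bayes:
  assumes M: "finite_measure M" "subalgebra M (F VV)"
    and integral: "\<And>f. f \<in> borel_measurable (F VV) \<Longrightarrow>
      integral\<^sup>N M f = (\<integral>\<^sup>+\<omega>. f (\<theta> \<omega>) * zprod (VV - \<A>) (\<theta> \<omega>) \<partial>Q)"
    and v: "v \<in> VV" "v \<notin> \<A>" and U: "down_closed U" "down_closed (insert v U)" "v \<notin> U"
    and \<eta>: "\<eta> \<in> borel_measurable (F {v})"
  shows "AE \<omega> in M. real_cond_exp M (F U) \<eta> \<omega> = bayes v \<eta> \<omega>"
proof -
  interpret M: finite_measure M by fact
  have UV: "U \<subseteq> VV" "{v} \<subseteq> VV" using U v by (auto simp: down_closed_def)
  have pU: "pst v \<subseteq> U" using U past_irrefl[of v] by (auto simp: down_closed_def)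
  have sub: "subalgebra M (F U)"
    using M(2) subalgebra_F_F[OF UV(1)] by (auto simp: subalgebra_def)
  interpret MU: finite_measure_subalgebra M "F U" by unfold_locales (rule sub)
  have *: "AE \<omega> in M. bayes_nn v e \<omega> = nn_cond_exp M (F U) e \<omega>" if e: "e \<in> borel_measurable (F {v})" for e
  proof (rule MU.nn_cond_exp_charact)
    have eV: "e \<in> borel_measurable (F VV)" by (rule F_measurable_mono[OF e UV(2)])
    show "e \<in> borel_measurable M" by (rule measurable_from_subalg[OF M(2) eV])
    show mU: "bayes_nn v e \<in> borel_measurable (F U)" by (rule F_measurable_mono[OF bayes_nn_measurable pU])
    have mV: "bayes_nn v e \<in> borel_measurable (F VV)" by (rule F_measurable_mono[OF mU UV(1)])
    fix A assume A: "A \<in> sets (F U)"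
    have AV: "A \<in> sets (F VV)" using A F_mono[OF UV(1)] by blast
    have i: "(indicator A :: 'a \<Rightarrow> ennreal) \<in> borel_measurable (F U)" using A by simp
    have "(\<integral>\<^sup>+\<omega>. e \<omega> * indicator A \<omega> \<partial>M) =
        (\<integral>\<^sup>+\<omega>. indicator A (\<theta> \<omega>) * e (\<theta> \<omega>) * zprod (VV - \<A>) (\<theta> \<omega>) \<partial>Q)"
      using eV AV by (subst integral) (auto simp: mult_ac)
    also have "\<dots> = (\<integral>\<^sup>+\<omega>. indicator A (\<theta> \<omega>) * bayes_nn v e (\<theta> \<omega>) * zprod (VV - \<A>) (\<theta> \<omega>) \<partial>Q)"
      by (rule nn_integral_bayes[OF v U i e])
    also have "\<dots> = (\<integral>\<^sup>+\<omega>. bayes_nn v e \<omega> * indicator A \<omega> \<partial>M)"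
      using mV AV by (subst integral) (auto simp: mult_ac)
    finally show "(\<integral>\<^sup>+\<omega>. e \<omega> * indicator A \<omega> \<partial>M) = (\<integral>\<^sup>+\<omega>. bayes_nn v e \<omega> * indicator A \<omega> \<partial>M)" .
  qed
  have "(\<lambda>\<omega>. ennreal (\<eta> \<omega>)) \<in> borel_measurable (F {v})" "(\<lambda>\<omega>. ennreal (- \<eta> \<omega>)) \<in> borel_measurable (F {v})"
    using \<eta> by measurable
  from *[OF this(1)] *[OF this(2)] show ?thesis
    by eventually_elim (simp add: real_cond_exp_def bayes_def)
qed

section \<open>The counterfactual measure\<close>

definition P\<theta> :: "'a measure" where
  "P\<theta> = density (restr_to_subalg (distr Q Q \<theta>) (F VV)) (\<lambda>\<omega>. ennreal (\<Prod>v\<in>VV - \<A>. Z v \<omega>))"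

lemma subalgebra_distr: "subalgebra (distr Q Q \<theta>) (F VV)"
  using subalgebra_F[of VV] by (simp add: subalgebra_def)

lemma sets_counterfactual: "sets P\<theta> = sets (F VV)" and space_counterfactual: "space P\<theta> = space Q"
  by (simp_all add: P\<theta>_def sets_restr_to_subalg[OF subalgebra_distr] space_restr_to_subalg)

lemma subalgebra_counterfactual: "W \<subseteq> VV \<Longrightarrow> subalgebra P\<theta> (F W)"
  using F_mono by (simp add: subalgebra_def sets_counterfactual space_counterfactual)

lemma measurable_counterfactual: "W \<subseteq> VV \<Longrightarrow> f \<in> F W \<rightarrow>\<^sub>M M \<Longrightarrow> f \<in> P\<theta> \<rightarrow>\<^sub>M M"
  using measurable_from_subalg subalgebra_counterfactual by blast

lemma prod_Z_measurable: "(\<lambda>\<omega>. ennreal (\<Prod>v\<in>VV - \<A>. Z v \<omega>)) \<in> borel_measurable (F VV)"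
  by (intro measurable_compose[OF _ measurable_ennreal] borel_measurable_prod
      Z_measurable_down_closed[OF down_closed_VV]) auto

lemma nn_integral_counterfactual_distr:
  assumes f: "f \<in> borel_measurable (F VV)"
  shows "integral\<^sup>N P\<theta> f =
    (\<integral>\<^sup>+\<omega>. ennreal (\<Prod>v\<in>VV - \<A>. Z v \<omega>) * f \<omega> \<partial>restr_to_subalg (distr Q Q \<theta>) (F VV))"
  unfolding P\<theta>_def
  by (rule nn_integral_density) (intro measurable_in_subalg[OF subalgebra_distr] f prod_Z_measurable)+

lemma nn_integral_counterfactual:
  assumes f: "f \<in> borel_measurable (F VV)"
  shows "integral\<^sup>N P\<theta> f = (\<integral>\<^sup>+\<omega>. f (\<theta> \<omega>) * zprod (VV - \<A>) (\<theta> \<omega>) \<partial>Q)"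
proof -
  let ?g = "\<lambda>\<omega>. ennreal (\<Prod>v\<in>VV - \<A>. Z v \<omega>) * f \<omega>"
  have g: "?g \<in> borel_measurable (F VV)" using f prod_Z_measurable by auto
  have "integral\<^sup>N P\<theta> f = integral\<^sup>N (distr Q Q \<theta>) ?g"
    unfolding nn_integral_counterfactual_distr[OF f] by (rule nn_integral_subalgebra2[OF subalgebra_distr g])
  also have "\<dots> = (\<integral>\<^sup>+\<omega>. ?g (\<theta> \<omega>) \<partial>Q)"
    by (rule nn_integral_distr[OF theta_measurable]) (use F_measurable_Q[OF g] in simp)
  also have "\<dots> = (\<integral>\<^sup>+\<omega>. f (\<theta> \<omega>) * zprod (VV - \<A>) (\<theta> \<omega>) \<partial>Q)"
    using measurable_space[OF theta_measurable] zprod_eq[of "VV - \<A>"]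
    by (intro nn_integral_cong) (simp add: mult.commute)
  finally show ?thesis .
qed

text \<open>Dropping all densities leaves the total mass of \<open>Q\<close>.\<close>

lemma prob_space_counterfactual: "prob_space P\<theta>"
proof (rule prob_spaceI)
  have "emeasure P\<theta> (space P\<theta>) = (\<integral>\<^sup>+\<omega>. 1 \<partial>P\<theta>)" by simp
  also have "\<dots> = (\<integral>\<^sup>+\<omega>. 1 * zprod (VV - \<A>) (\<theta> \<omega>) \<partial>Q)" by (rule nn_integral_counterfactual) simp
  also have "\<dots> = (\<integral>\<^sup>+\<omega>. 1 * zprod ({} - \<A>) (\<theta> \<omega>) \<partial>Q)"
    by (rule nn_integral_drop_later_densities[OF down_closed_empty down_closed_VV, where f = "\<lambda>_. 1"]) auto
  also have "\<dots> = 1" using emeasure_space_1 by (simp add: zprod_def)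
  finally show "emeasure P\<theta> (space P\<theta>) = 1" .
qed

lemma AE_counterfactual:
  assumes "AE \<omega> in Q. \<phi> (\<theta> \<omega>)" "{\<omega> \<in> space Q. \<phi> \<omega>} \<in> sets (F VV)"
  shows "AE \<omega> in P\<theta>. \<phi> \<omega>"
proof -
  let ?N = "{\<omega> \<in> space Q. \<not> \<phi> \<omega>}"
  have "?N = space Q - {\<omega> \<in> space Q. \<phi> \<omega>}" by auto
  then have N: "?N \<in> sets (F VV)" using sets.compl_sets[OF assms(2)] by simp
  have "emeasure P\<theta> ?N = (\<integral>\<^sup>+\<omega>. indicator ?N \<omega> \<partial>P\<theta>)" using N by (simp add: sets_counterfactual)
  also have "\<dots> = (\<integral>\<^sup>+\<omega>. indicator ?N (\<theta> \<omega>) * zprod (VV - \<A>) (\<theta> \<omega>) \<partial>Q)"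
    by (rule nn_integral_counterfactual) (use N in simp)
  also have "\<dots> = (\<integral>\<^sup>+\<omega>. 0 \<partial>Q)"
    using assms(1) by (intro nn_integral_cong_AE) (auto elim: eventually_mono)
  finally have "?N \<in> null_sets P\<theta>" using N by (simp add: null_sets_def sets_counterfactual)
  then show ?thesis by (rule AE_I') (auto simp: space_counterfactual)
qed

lemma null_sets_counterfactual: "A \<in> null_sets Q \<Longrightarrow> A \<in> null_sets P\<theta>"
proof -
  assume A: "A \<in> null_sets Q"
  have AF: "A \<in> sets (F VV)" using A null_sets_F by blast
  have "{\<omega> \<in> space Q. \<omega> \<notin> A} = space Q - A" by auto
  then have "AE \<omega> in P\<theta>. \<omega> \<notin> A"
    using AE_theta[OF AE_not_in[OF A]] sets.compl_sets[OF AF] by (intro AE_counterfactual) simp_all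
  then show "A \<in> null_sets P\<theta>" using AF by (subst AE_iff_null_sets) (auto simp: sets_counterfactual)
qed

text \<open>
  The counterfactual measure is absolutely continuous with respect to the image of \<open>Q\<close> under \<open>\<theta>\<close>, so
  the claim amounts to \<open>f(\<theta>(\<theta> \<omega>)) = f(\<theta> \<omega>)\<close> almost surely under \<open>Q\<close>. This holds because \<open>f \<circ> \<theta>\<close>
  depends on non-intervened modules only.
\<close>

lemma counterfactual_theta_invariant:
  fixes f :: "'a \<Rightarrow> real"
  assumes "f \<in> borel_measurable (F VV)" "W \<subseteq> VV - \<A>" "(\<lambda>\<omega>. f (\<theta> \<omega>)) \<in> borel_measurable (F W)"
  shows "AE \<omega> in P\<theta>. f (\<theta> \<omega>) = f \<omega>"
proof (rule AE_counterfactual)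
  show "AE \<omega> in Q. f (\<theta> (\<theta> \<omega>)) = f (\<theta> \<omega>)" by (rule comp_theta_invariant[OF assms(2,3)])
  have "(\<lambda>\<omega>. f (\<theta> \<omega>)) \<in> borel_measurable (F VV)" by (rule F_measurable_mono[OF assms(3)]) (use assms(2) in auto)
  then have "{\<omega> \<in> space (F VV). f (\<theta> \<omega>) = f \<omega>} \<in> sets (F VV)" using assms(1) by measurable
  then show "{\<omega> \<in> space Q. f (\<theta> \<omega>) = f \<omega>} \<in> sets (F VV)" by simp
qed

text \<open>
  For a non-intervened \<open>v\<close> the Bayes formula is the same for every \<open>U\<close>. For an intervened \<open>v\<close> the
  indicator of \<open>A\<close> agrees almost surely with its pullback, a function of the past of \<open>v\<close>, and therefore
  is its own conditional expectation.
\<close>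

lemma real_cond_exp_counterfactual_past:
  assumes v: "v \<in> VV" and U: "down_closed U" "down_closed (insert v U)" "v \<notin> U"
    and A: "A \<in> sets (F {v})"
  shows "AE \<omega> in P\<theta>. real_cond_exp P\<theta> (F U) (indicator A) \<omega> = real_cond_exp P\<theta> (F (pst v)) (indicator A) \<omega>"
proof -
  interpret cf: prob_space P\<theta> by (rule prob_space_counterfactual)
  have UV: "U \<subseteq> VV" using U by (simp add: down_closed_def)
  have pU: "pst v \<subseteq> U" using U past_irrefl[of v] by (auto simp: down_closed_def)
  let ?a = "indicator A :: 'a \<Rightarrow> real"
  have a: "?a \<in> borel_measurable (F {v})" using A by simp
  show ?thesis
  proof (cases "v \<in> \<A>")
    case False
    have "AE \<omega> in P\<theta>. real_cond_exp P\<theta> (F W) ?a \<omega> = bayes v ?a \<omega>"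
      if "down_closed W" "down_closed (insert v W)" "v \<notin> W" for W
      using that
      by (intro real_cond_exp_bayes[OF cf.finite_measure_axioms subalgebra_counterfactual nn_integral_counterfactual v False _ _ _ a]) auto
    from this[OF U] this[OF down_closed_past down_closed_past_insert[OF v] past_irrefl]
    show ?thesis by eventually_elim simp
  next
    case True
    let ?b = "\<lambda>\<omega>. ?a (\<theta> \<omega>)"
    have b: "?b \<in> borel_measurable (F (pst v \<inter> (VV - \<A>)))"
      using action True a unfolding baseline_action_def by blast
    have aV: "?a \<in> borel_measurable (F VV)" by (rule F_measurable_mono[OF a]) (use v in auto)
    have bV: "?b \<in> borel_measurable (F VV)" by (rule F_measurable_mono[OF b]) auto
    have ba: "AE \<omega> in P\<theta>. ?b \<omega> = ?a \<omega>" by (rule counterfactual_theta_invariant[OF aV _ b]) auto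
    have bcf: "?b \<in> borel_measurable P\<theta>" and acf: "?a \<in> borel_measurable P\<theta>"
      using measurable_counterfactual[OF subset_refl] aV bV by auto
    have "AE \<omega> in P\<theta>. real_cond_exp P\<theta> (F W) ?a \<omega> = ?b \<omega>" if W: "pst v \<subseteq> W" "W \<subseteq> VV" for W
    proof -
      interpret W: finite_measure_subalgebra P\<theta> "F W" by unfold_locales (rule subalgebra_counterfactual[OF W(2)])
      have bW: "?b \<in> borel_measurable (F W)" by (rule F_measurable_mono[OF b]) (use W in auto)
      have "integrable P\<theta> ?b"
        by (rule cf.integrable_const_bound[where B = 1]) (use bcf in \<open>auto simp: indicator_def\<close>)
      then have "AE \<omega> in P\<theta>. real_cond_exp P\<theta> (F W) ?b \<omega> = ?b \<omega>" by (rule W.real_cond_exp_F_meas[OF _ bW])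
      moreover have "AE \<omega> in P\<theta>. real_cond_exp P\<theta> (F W) ?b \<omega> = real_cond_exp P\<theta> (F W) ?a \<omega>"
        by (rule W.real_cond_exp_cong[OF ba bcf acf])
      ultimately show ?thesis by eventually_elim simp
    qed
    from this[OF pU UV] this[OF subset_refl past_subset] show ?thesis by eventually_elim simp
  qed
qed

lemma imposes_contemp_indep_counterfactual: "imposes_contemp_indep VV T N X P\<theta>"
proof -
  interpret cf: prob_space P\<theta> by (rule prob_space_counterfactual)
  have "X v \<in> P\<theta> \<rightarrow>\<^sub>M N v" if v: "v \<in> VV" for v
  proof (rule measurableI)
    show "X v \<omega> \<in> space (N v)" if "\<omega> \<in> space P\<theta>" for \<omega>
      using measurable_space[OF X_measurable[OF v]] that by (simp add: space_counterfactual)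
    show "X v -` S \<inter> space P\<theta> \<in> sets P\<theta>" if "S \<in> sets (N v)" for S
      using generator_in_F[OF v that] by (simp add: space_counterfactual sets_counterfactual)
  qed
  moreover have "cond_indep_sigma P\<theta> (B (pst v)) (B {v}) (B ({w \<in> VV. T w = T v} - {v}))"
    if v: "v \<in> VV" for v
  proof -
    \<comment> \<open>The past of \<open>v\<close> together with its contemporaries.\<close>
    define U where "U = {w \<in> VV. T w \<le> T v} - {v}"
    have U: "down_closed U" "down_closed (insert v U)" "v \<notin> U"
      using v by (auto simp: U_def down_closed_def past_def)
    have UV: "U \<subseteq> VV" and pU: "pst v \<subseteq> U" and cU: "{w \<in> VV. T w = T v} - {v} \<subseteq> U"
      by (auto simp: U_def past_def)
    have vV: "{v} \<subseteq> VV" using v by simp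
    have BF: "sets (B W) \<subseteq> sets (F W)" for W using subalgebra_F_B[of W] by (simp add: subalgebra_def)
    have sub: "subalgebra (F U) (B (pst v))"
      using BF[of "pst v"] F_mono[OF pU] by (auto simp: subalgebra_def)
    show ?thesis
    proof (rule cond_indep_sigmaI[OF cf.finite_measure_axioms subalgebra_counterfactual[OF UV] sub])
      show "sets (B {v}) \<subseteq> sets P\<theta>" using BF[of "{v}"] F_mono[OF vV] by (auto simp: sets_counterfactual)
      show "sets (B ({w \<in> VV. T w = T v} - {v})) \<subseteq> sets (F U)" using BF F_mono[OF cU] by blast
      fix A assume "A \<in> sets (B {v})"
      then have A: "A \<in> sets (F {v})" using BF by blast
      then have Acf: "A \<in> sets P\<theta>" using F_mono[OF vV] by (auto simp: sets_counterfactual)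
      have "AE \<omega> in P\<theta>. real_cond_exp P\<theta> (F (pst v)) (indicator A) \<omega> =
          real_cond_exp P\<theta> (B (pst v)) (indicator A) \<omega>"
      proof (rule real_cond_exp_agree_mod_null[OF cf.finite_measure_axioms subalgebra_counterfactual[OF past_subset] subalgebra_F_B])
        show "\<exists>D\<in>sets (B (pst v)). agree_mod_null P\<theta> C D" if "C \<in> sets (F (pst v))" for C
          using F_approx[OF past_subset that] null_sets_counterfactual unfolding agree_mod_null_def by blast
        show "integrable P\<theta> (indicat_real A)"
          using Acf by (simp add: integrable_indicator_iff less_top[symmetric])
      qed
      with real_cond_exp_counterfactual_past[OF v U A]
      show "AE \<omega> in P\<theta>. real_cond_exp P\<theta> (F U) (indicator A) \<omega> =
          real_cond_exp P\<theta> (B (pst v)) (indicator A) \<omega>"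
        by eventually_elim simp
    qed
  qed
  ultimately show ?thesis
    unfolding imposes_contemp_indep_def space_counterfactual using prob_space_counterfactual by blast
qed

text \<open>
  Zeros of the factual density that come from intervened modules need not be zeros of the weight in
  the definition of the counterfactual measure. At such points the bound forces the density of the image
  measure to vanish.
\<close>

lemma counterfactual_absolutely_continuous:
  assumes P: "sets P = events"
    and integral: "\<And>f. f \<in> borel_measurable (F VV) \<Longrightarrow> integral\<^sup>N P f = (\<integral>\<^sup>+\<omega>. f \<omega> * zprod VV \<omega> \<partial>Q)"
    and bound: "AE \<omega> in Q. RN_deriv (restr_to_subalg Q (F VV)) (restr_to_subalg (distr Q Q \<theta>) (F VV)) \<omega>
             \<le> ennreal (K \<omega> * (\<Prod>v\<in>\<A>. Z v \<omega>))"
  shows "absolutely_continuous (restr_to_subalg P (F VV)) P\<theta>"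
  unfolding absolutely_continuous_def
proof
  let ?Q = "restr_to_subalg Q (F VV)" and ?R = "restr_to_subalg (distr Q Q \<theta>) (F VV)"
  have sub: "subalgebra Q (F VV)" "subalgebra P (F VV)"
    using subalgebra_F[of VV] P sets_eq_imp_space_eq[OF P] by (auto simp: subalgebra_def)
  interpret R: finite_measure ?Q
    by (rule finite_measure_restr_to_subalg[OF sub(1)]) unfold_locales
  have ac: "absolutely_continuous ?Q ?R"
    using action by (auto simp: absolutely_continuous_def baseline_action_def
        null_sets_restr_to_subalg sub subalgebra_distr)
  let ?D = "RN_deriv ?Q ?R"
  have D: "?D \<in> borel_measurable (F VV)" by (rule measurable_in_subalg'[OF sub(1) borel_measurable_RN_deriv])
  fix C assume "C \<in> null_sets (restr_to_subalg P (F VV))"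
  then have "C \<in> null_sets P \<inter> sets (F VV)" unfolding null_sets_restr_to_subalg[OF sub(2)] .
  then have C: "C \<in> sets (F VV)" and PC: "emeasure P C = 0" by auto
  have CP: "C \<in> sets P" using C sub(2) by (auto simp: subalgebra_def)
  have "(\<integral>\<^sup>+\<omega>. indicator C \<omega> * zprod VV \<omega> \<partial>Q) = 0"
    using integral[of "indicator C"] C CP PC by simp
  moreover have "(\<lambda>\<omega>. indicator C \<omega> * zprod VV \<omega>) \<in> borel_measurable Q"
    using F_measurable_Q[OF zprod_measurable[OF down_closed_VV subset_refl]] F_events[OF C] by auto
  ultimately have zero: "AE \<omega> in Q. indicator C \<omega> * zprod VV \<omega> = 0"
    by (simp add: nn_integral_0_iff_AE)
  let ?f = "\<lambda>\<omega>. ennreal (\<Prod>v\<in>VV - \<A>. Z v \<omega>) * indicator C \<omega>"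
  have f: "?f \<in> borel_measurable (F VV)" using C prod_Z_measurable by auto
  have "emeasure P\<theta> C = integral\<^sup>N P\<theta> (indicator C)" using C by (simp add: sets_counterfactual)
  also have "\<dots> = (\<integral>\<^sup>+\<omega>. ?f \<omega> \<partial>?R)" by (rule nn_integral_counterfactual_distr) (use C in simp)
  also have "\<dots> = (\<integral>\<^sup>+\<omega>. ?D \<omega> * ?f \<omega> \<partial>?Q)"
    by (rule R.RN_deriv_nn_integral[OF ac])
       (use sub subalgebra_distr measurable_in_subalg[OF sub(1) f] in \<open>simp_all add: sets_restr_to_subalg\<close>)
  also have "\<dots> = (\<integral>\<^sup>+\<omega>. ?D \<omega> * ?f \<omega> \<partial>Q)"
    by (rule nn_integral_subalgebra2[OF sub(1)]) (use D f in auto)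
  also have "\<dots> = (\<integral>\<^sup>+\<omega>. 0 \<partial>Q)"
  proof (rule nn_integral_cong_AE)
    show "AE \<omega> in Q. ?D \<omega> * ?f \<omega> = 0"
      using bound zero AE_space
    proof eventually_elim
      case (elim \<omega>)
      have "zprod VV \<omega> = ennreal (\<Prod>v\<in>VV - \<A>. Z v \<omega>) * ennreal (\<Prod>v\<in>\<A>. Z v \<omega>)"
        unfolding zprod_eq[OF Diff_subset elim(3)] zprod_eq[OF A_subset elim(3)]
        unfolding zprod_def by (rule prod.subset_diff[OF A_subset finite_VV])
      with elim(2) consider "\<omega> \<notin> C" | "ennreal (\<Prod>v\<in>VV - \<A>. Z v \<omega>) = 0" | "ennreal (\<Prod>v\<in>\<A>. Z v \<omega>) = 0"
        by (auto split: split_indicator_asm)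
      then show ?case
      proof cases
        case 3
        then have "(\<Prod>v\<in>\<A>. Z v \<omega>) = 0"
          using prod_nonneg[of \<A> "\<lambda>v. Z v \<omega>"] Z_nonneg A_subset elim(3) by (force simp: ennreal_eq_0_iff)
        then show ?thesis using elim(1) by simp
      qed auto
    qed
  qed
  finally show "C \<in> null_sets P\<theta>" using C by (simp add: null_sets_def sets_counterfactual)
qed

text \<open>
  A version \<open>m\<close> of the factual conditional expectation is tied to the Bayes formula only \<open>P\<close>-almost
  surely; absolute continuity makes this hold under the counterfactual measure as well, where the
  Bayes formula is the conditional expectation and composition with \<open>\<theta>\<close> does not change \<open>m\<close>.
\<close>

lemma counterfactual_at_baseline_counterfactual:
  assumes P: "prob_space P" "sets P = events"
    and integral: "\<And>f. f \<in> borel_measurable (F VV) \<Longrightarrow> integral\<^sup>N P f = (\<integral>\<^sup>+\<omega>. f \<omega> * zprod VV \<omega> \<partial>Q)"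
    and ac: "absolutely_continuous (restr_to_subalg P (F VV)) P\<theta>"
  shows "counterfactual_at_baseline VV T N X Q P \<A> \<theta> P\<theta>"
proof -
  interpret P: prob_space P by fact
  interpret cf: prob_space P\<theta> by (rule prob_space_counterfactual)
  have subP: "subalgebra P (F VV)"
    using subalgebra_F[of VV] P(2) sets_eq_imp_space_eq[OF P(2)] by (auto simp: subalgebra_def)
  \<comment> \<open>The factual measure is the case of no intervention.\<close>
  interpret identity: baseline_intervention Q VV T N X Z "{}" "\<lambda>\<omega>. \<omega>"
    by unfold_locales (auto simp: baseline_action_def absolutely_continuous_def distr_id2)
  have bounded_counterfactual: "\<exists>c. \<forall>\<omega>\<in>space P\<theta>. \<bar>f \<omega>\<bar> \<le> c" if "bounded (f ` space Q)" for f :: "'a \<Rightarrow> real"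
    using that by (auto simp: bounded_iff space_counterfactual)
  have main: "(v \<in> \<A> \<longrightarrow> (\<integral>\<omega>. h \<omega> * \<eta> \<omega> \<partial>P\<theta>) = (\<integral>\<omega>. h \<omega> * \<eta> (\<theta> \<omega>) \<partial>P\<theta>)) \<and>
      (v \<in> VV - \<A> \<longrightarrow> (\<forall>m. m \<in> borel_measurable (F (pst v)) \<longrightarrow>
         (AE \<omega> in P. m \<omega> = real_cond_exp P (F (pst v)) \<eta> \<omega>) \<longrightarrow>
         integrable P\<theta> (\<lambda>\<omega>. h \<omega> * m (\<theta> \<omega>)) \<and>
         (\<integral>\<omega>. h \<omega> * \<eta> \<omega> \<partial>P\<theta>) = (\<integral>\<omega>. h \<omega> * m (\<theta> \<omega>) \<partial>P\<theta>)))"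
    if v: "v \<in> VV" and \<eta>: "\<eta> \<in> borel_measurable (F {v})" "bounded (\<eta> ` space Q)"
      and h: "h \<in> borel_measurable (F (pst v))" "bounded (h ` space Q)" for v and \<eta> h :: "'a \<Rightarrow> real"
  proof -
    have \<eta>V: "\<eta> \<in> borel_measurable (F VV)" by (rule F_measurable_mono[OF \<eta>(1)]) (use v in auto)
    have hV: "h \<in> borel_measurable (F VV)" by (rule F_measurable_mono[OF h(1) past_subset])
    note cfm = measurable_counterfactual[OF subset_refl]
    have \<eta>cf: "\<eta> \<in> borel_measurable P\<theta>" and hcf: "h \<in> borel_measurable P\<theta>" using cfm \<eta>V hV by auto
    have \<theta>V: "(\<lambda>\<omega>. f (\<theta> \<omega>)) \<in> borel_measurable P\<theta>" if "f \<in> borel_measurable (F VV)" for f :: "'a \<Rightarrow> real"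
      by (rule measurable_counterfactual[OF _ comp_theta_measurable[OF down_closed_VV that]]) auto
    show ?thesis
    proof (intro conjI impI allI)
      assume vA: "v \<in> \<A>"
      have "(\<lambda>\<omega>. \<eta> (\<theta> \<omega>)) \<in> borel_measurable (F (pst v \<inter> (VV - \<A>)))"
        using action vA \<eta> unfolding baseline_action_def by blast
      then have "AE \<omega> in P\<theta>. \<eta> (\<theta> \<omega>) = \<eta> \<omega>" by (intro counterfactual_theta_invariant[OF \<eta>V, of "pst v \<inter> (VV - \<A>)"]) auto
      then show "(\<integral>\<omega>. h \<omega> * \<eta> \<omega> \<partial>P\<theta>) = (\<integral>\<omega>. h \<omega> * \<eta> (\<theta> \<omega>) \<partial>P\<theta>)"
        using \<eta>cf hcf \<theta>V[OF \<eta>V] by (intro integral_cong_AE) auto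
    next
      fix m :: "'a \<Rightarrow> real"
      assume v': "v \<in> VV - \<A>" and m: "m \<in> borel_measurable (F (pst v))"
        and mP: "AE \<omega> in P. m \<omega> = real_cond_exp P (F (pst v)) \<eta> \<omega>"
      have mV: "m \<in> borel_measurable (F VV)" by (rule F_measurable_mono[OF m past_subset])
      note past = down_closed_past down_closed_past_insert[OF v] past_irrefl
      interpret p: finite_measure_subalgebra P\<theta> "F (pst v)" by unfold_locales (rule subalgebra_counterfactual[OF past_subset])
      have "AE \<omega> in P. real_cond_exp P (F (pst v)) \<eta> \<omega> = bayes v \<eta> \<omega>"
        by (rule identity.real_cond_exp_bayes[OF P.finite_measure_axioms subP _ v _ past \<eta>(1)])
           (simp_all add: integral)
      with mP have "AE \<omega> in P. m \<omega> = bayes v \<eta> \<omega>" by eventually_elim simp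
      moreover have "Measurable.pred (F VV) (\<lambda>\<omega>. m \<omega> = bayes v \<eta> \<omega>)"
        using mV F_measurable_mono[OF bayes_measurable past_subset] by measurable
      ultimately have "AE \<omega> in restr_to_subalg P (F VV). m \<omega> = bayes v \<eta> \<omega>"
        by (intro AE_restr_to_subalg2[OF subP])
      then have mb: "AE \<omega> in P\<theta>. m \<omega> = bayes v \<eta> \<omega>"
        by (rule absolutely_continuous_AE[OF _ ac, rotated]) (simp add: sets_counterfactual sets_restr_to_subalg[OF subP])
      have "AE \<omega> in P\<theta>. real_cond_exp P\<theta> (F (pst v)) \<eta> \<omega> = bayes v \<eta> \<omega>"
        using v' by (intro real_cond_exp_bayes[OF cf.finite_measure_axioms subalgebra_counterfactual nn_integral_counterfactual v _ past \<eta>(1)]) auto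
      moreover have "AE \<omega> in P\<theta>. m (\<theta> \<omega>) = m \<omega>"
        by (rule counterfactual_theta_invariant[OF mV _ comp_theta_measurable[OF down_closed_past m]]) (auto simp: past_def)
      ultimately have eq: "AE \<omega> in P\<theta>. h \<omega> * real_cond_exp P\<theta> (F (pst v)) \<eta> \<omega> = h \<omega> * m (\<theta> \<omega>)"
        using mb by eventually_elim simp
      obtain c d where cd: "\<And>\<omega>. \<omega> \<in> space P\<theta> \<Longrightarrow> \<bar>h \<omega>\<bar> \<le> c" "\<And>\<omega>. \<omega> \<in> space P\<theta> \<Longrightarrow> \<bar>\<eta> \<omega>\<bar> \<le> d"
        using bounded_counterfactual[OF \<eta>(2)] bounded_counterfactual[OF h(2)] by blast
      have int: "integrable P\<theta> (\<lambda>\<omega>. h \<omega> * \<eta> \<omega>)"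
      proof (rule cf.integrable_const_bound[where B = "c * d"])
        show "AE \<omega> in P\<theta>. norm (h \<omega> * \<eta> \<omega>) \<le> c * d"
        proof (rule AE_I2)
          fix \<omega> assume \<omega>: "\<omega> \<in> space P\<theta>"
          have "0 \<le> c" using cd(1)[OF \<omega>] abs_ge_zero order_trans by blast
          then show "norm (h \<omega> * \<eta> \<omega>) \<le> c * d"
            using mult_mono[OF cd(1)[OF \<omega>] cd(2)[OF \<omega>]] by (simp add: abs_mult)
        qed
      qed (use \<eta>cf hcf in simp)
      have hm: "(\<lambda>\<omega>. h \<omega> * m (\<theta> \<omega>)) \<in> borel_measurable P\<theta>" using hcf \<theta>V[OF mV] by simp
      note E = p.real_cond_exp_intg[OF int h(1) \<eta>cf]
      show "integrable P\<theta> (\<lambda>\<omega>. h \<omega> * m (\<theta> \<omega>))"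
        by (rule integrable_cong_AE_imp[OF E(1) hm]) (use eq in \<open>elim eventually_mono, simp\<close>)
      have "(\<integral>\<omega>. h \<omega> * real_cond_exp P\<theta> (F (pst v)) \<eta> \<omega> \<partial>P\<theta>) = (\<integral>\<omega>. h \<omega> * m (\<theta> \<omega>) \<partial>P\<theta>)"
        by (rule integral_cong_AE[OF _ hm eq]) (use E(1) in simp)
      then show "(\<integral>\<omega>. h \<omega> * \<eta> \<omega> \<partial>P\<theta>) = (\<integral>\<omega>. h \<omega> * m (\<theta> \<omega>) \<partial>P\<theta>)" using E(2) by simp
    qed
  qed
  show ?thesis
    unfolding counterfactual_at_baseline_def
  proof (intro conjI ballI allI impI)
    show "prob_space P\<theta>" "sets P\<theta> = sets (F VV) \<or> sets P\<theta> = sets Q"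
      by (simp_all add: prob_space_counterfactual sets_counterfactual)
  qed (use main in blast)+
qed

end

theorem theorem1:
  fixes VV \<A> :: "'v set"
    and T :: "'v \<Rightarrow> real"
    and Q P :: "'a measure"
    and N :: "'v \<Rightarrow> 'b measure"
    and X :: "'v \<Rightarrow> 'a \<Rightarrow> 'b"
    and Z :: "'v \<Rightarrow> 'a \<Rightarrow> real"
    and \<theta> :: "'a \<Rightarrow> 'a"
    and K :: "'a \<Rightarrow> real"
  assumes "finite VV"
    and "prob_space Q"
    and "prob_space.indep_vars Q N X VV"
    and "\<forall>v\<in>VV. T v \<le> 0"
    and "prob_space P" and "sets P = sets Q"
    and "absolutely_continuous Q P"
    and "imposes_contemp_indep VV T N X P"
    and "\<forall>v\<in>VV. \<forall>\<omega>\<in>space Q. 0 \<le> Z v \<omega>"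
    and "\<forall>v\<in>VV. Z v \<in> borel_measurable (F0 Q N X (past VV T v \<union> {v}))"
    and "\<forall>v\<in>VV. AE \<omega> in Q.
           nn_cond_exp Q (F0 Q N X (past VV T v)) (\<lambda>\<omega>. ennreal (Z v \<omega>)) \<omega> = 1"
    and "AE \<omega> in Q.
           RN_deriv (restr_to_subalg Q (F0 Q N X VV)) (restr_to_subalg P (F0 Q N X VV)) \<omega>
             = ennreal (\<Prod>v\<in>VV. Z v \<omega>)"
    and "\<A> \<subseteq> VV"
    and "baseline_action VV T N X Q \<A> \<theta>"
    and "\<forall>\<omega>\<in>space Q. 0 \<le> K \<omega>"
    and "integrable (restr_to_subalg P (F0 Q N X VV)) K"
    and "AE \<omega> in Q.
           RN_deriv (restr_to_subalg Q (F0 Q N X VV))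
                    (restr_to_subalg (distr Q Q \<theta>) (F0 Q N X VV)) \<omega>
             \<le> ennreal (K \<omega> * (\<Prod>v\<in>\<A>. Z v \<omega>))"
  shows "let P\<theta> = density (restr_to_subalg (distr Q Q \<theta>) (F0 Q N X VV))
                    (\<lambda>\<omega>. ennreal (\<Prod>v\<in>VV - \<A>. Z v \<omega>))
         in sets P\<theta> = sets (F0 Q N X VV) \<and>
            counterfactual_at_baseline VV T N X Q P \<A> \<theta> P\<theta> \<and>
            absolutely_continuous (restr_to_subalg P (F0 Q N X VV)) P\<theta> \<and>
            imposes_contemp_indep VV T N X P\<theta>"
proof -
  interpret baseline_intervention Q VV T N X Z \<A> \<theta>
    using assms
    by (simp add: baseline_intervention_def baseline_intervention_axioms_def baseline_densities_def
        baseline_densities_axioms_def baseline_variables_def baseline_variables_axioms_def)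
  have integral: "integral\<^sup>N P f = (\<integral>\<^sup>+\<omega>. f \<omega> * zprod VV \<omega> \<partial>Q)" if "f \<in> borel_measurable (F0 Q N X VV)" for f
    using assms(6,7,12) that by (rule nn_integral_factual)
  have ac: "absolutely_continuous (restr_to_subalg P (F0 Q N X VV)) P\<theta>"
    using assms(6) integral assms(17) by (rule counterfactual_absolutely_continuous)
  have "counterfactual_at_baseline VV T N X Q P \<A> \<theta> P\<theta>"
    using assms(5,6) integral ac by (rule counterfactual_at_baseline_counterfactual)
  then show ?thesis
    using sets_counterfactual ac imposes_contemp_indep_counterfactual by (simp add: Let_def P\<theta>_def)
qed

end
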